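(* Let $N\geq 1$ be an integer, and let $\{B_\alpha : \alpha\in\mathcal{A}\}$ and $\{B'_\alpha : \alpha\in\mathcal{A}\}$ be two collections of open balls in $\mathbb{R}^N_\infty$, indexed by the same set $\mathcal{A}$. Suppose that $\bigcap_{\alpha\in\mathcal{A}}\partial B_\alpha=\emptyset$. Then the following two conditions are equivalent: (i) there is a Möbius transformation $f$ of $\mathbb{R}^N_\infty$ such that either $f(B_\alpha)=B'_\alpha$ for every $\alpha\in\mathcal{A}$, or else $f(\widehat{B_\alpha})=B'_\alpha$ for every $\alpha\in\mathcal{A}$; (ii) $[B_\alpha,B_\beta]=[B'_\alpha,B'_\beta]$ for all pairs $\alpha$ and $\beta$ in $\mathcal{A}$.
   Context: $\mathbb{R}^N_\infty=\mathbb{R}^N\cup\{\infty\}$ is the one-point extension (compactification) of $\mathbb{R}^N$. A sphere in $\mathbb{R}^N_\infty$ is either an $(N-1)$-dimensional Euclidean sphere in $\mathbb{R}^N$, or an $(N-1)$-dimensional Euclidean (affine) plane in $\mathbb{R}^N$ with the point $\infty$ attached. An inversion in a sphere is the Euclidean inversion in it if it is a Euclidean sphere, and the Euclidean reflection in it (fixing $\infty$) if it is a Euclidean plane with $\infty$ attached. The group of Möbius transformations of $\mathbb{R}^N_\infty$ is the group generated by inversions in spheres (so it includes orientation-reversing maps). An open ball $B$ in $\mathbb{R}^N_\infty$ is one of the two connected components of the complement in $\mathbb{R}^N_\infty$ of a sphere; $\widehat{B}$ denotes the other component, and $\partial B$ is the sphere bounding $B$. The signed inversive distance $[B_1,B_2]$: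 if $B_1,B_2$ are Euclidean balls in $\mathbb{R}^N$ with centres $c_1,c_2$ and radii $r_1,r_2$, then $$[B_1,B_2]=\frac{r_1^2+r_2^2-|c_1-c_2|^2}{2r_1r_2}$$ (in particular $[B,B]=1$). For arbitrary open balls $B_1,B_2$ in $\mathbb{R}^N_\infty$, if there is a Möbius transformation $g$ such that $g(B_1)$ and $g(B_2)$ are both Euclidean balls, then $[B_1,B_2]=[g(B_1),g(B_2)]$, which does not depend on the choice of $g$. In the remaining case (no such $g$ exists) the value is determined by the rule $[\widehat{B_1},B_2]=-[B_1,B_2]$, which holds for all open balls. The quantity $[B_1,B_2]$ is symmetric and invariant under Möbius transformations. *)

theory Defs
  imports "HOL-Analysis.Analysis" "HOL-Algebra.Bij" "HOL-Algebra.Generated_Groups"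
begin

text \<open>
  The one-point extension of a Euclidean space is carried by the type \<^typ>\<open>'a option\<close>,
  with \<^const>\<open>None\<close> as the point at infinity and the topology
  \<^term>\<open>Alexandroff_compactification euclidean\<close>.
\<close>

definition euclidean_sphere :: "'a::euclidean_space \<Rightarrow> real \<Rightarrow> 'a option set" where
  "euclidean_sphere c r = Some ` sphere c r"

definition extended_plane :: "'a::euclidean_space \<Rightarrow> real \<Rightarrow> 'a option set" where
  "extended_plane a b = insert None (Some ` {x. a \<bullet> x = b})"

definition ext_spheres :: "'a::euclidean_space option set set" where
  "ext_spheres =
     {euclidean_sphere c r | c r. 0 < r} \<union> {extended_plane a b | a b. a \<noteq> 0}"

definition sphere_inversion :: "'a::euclidean_space \<Rightarrow> real \<Rightarrow> 'a option \<Rightarrow> 'a option" where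
  "sphere_inversion c r p =
     (case p of
        None \<Rightarrow> Some c
      | Some x \<Rightarrow> if x = c then None else Some (c + (r\<^sup>2 / (norm (x - c))\<^sup>2) *\<^sub>R (x - c)))"

definition plane_reflection :: "'a::euclidean_space \<Rightarrow> real \<Rightarrow> 'a option \<Rightarrow> 'a option" where
  "plane_reflection a b = map_option (\<lambda>x. x - (2 * (a \<bullet> x - b) / (a \<bullet> a)) *\<^sub>R a)"

definition inversions :: "('a::euclidean_space option \<Rightarrow> 'a option) set" where
  "inversions =
     {sphere_inversion c r | c r. 0 < r} \<union> {plane_reflection a b | a b. a \<noteq> 0}"

definition mobius_group :: "('a::euclidean_space option \<Rightarrow> 'a option) set" where
  "mobius_group = generate (BijGroup UNIV) inversions"

definition complement_components :: "'a::euclidean_space option set \<Rightarrow> 'a option set set" where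
  "complement_components S =
     connected_components_of (subtopology (Alexandroff_compactification euclidean) (- S))"

definition is_open_ball :: "'a::euclidean_space option set \<Rightarrow> bool" where
  "is_open_ball B \<longleftrightarrow> (\<exists>S\<in>ext_spheres. B \<in> complement_components S)"

definition bounding_sphere :: "'a::euclidean_space option set \<Rightarrow> 'a option set" where
  "bounding_sphere B = (THE S. S \<in> ext_spheres \<and> B \<in> complement_components S)"

definition opposite_ball :: "'a::euclidean_space option set \<Rightarrow> 'a option set" where
  "opposite_ball B = (THE C. C \<in> complement_components (bounding_sphere B) \<and> C \<noteq> B)"

text \<open>
  \<open>mobius_inv_dist B1 B2 d\<close>: some Moebius transformation maps both balls to Euclidean
  balls, and \<open>d\<close> is the value of the explicit formula for these images.
\<close>

definition mobius_inv_dist ::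
    "'a::euclidean_space option set \<Rightarrow> 'a option set \<Rightarrow> real \<Rightarrow> bool" where
  "mobius_inv_dist B1 B2 d \<longleftrightarrow>
     (\<exists>g\<in>mobius_group. \<exists>c1 r1 c2 r2. 0 < r1 \<and> 0 < r2 \<and>
        g ` B1 = Some ` ball c1 r1 \<and> g ` B2 = Some ` ball c2 r2 \<and>
        d = (r1\<^sup>2 + r2\<^sup>2 - (norm (c1 - c2))\<^sup>2) / (2 * r1 * r2))"

text \<open>
  No suitable transformation exists exactly when the closures of \<open>B1\<close> and \<open>B2\<close> cover the
  whole space.  Then the closure of \<open>opposite_ball B1\<close> lies in that of \<open>B2\<close>, so one exists
  for \<open>opposite_ball B1\<close> and \<open>B2\<close>, and the sign rule determines the value.
\<close>

definition inv_dist :: "'a::euclidean_space option set \<Rightarrow> 'a option set \<Rightarrow> real" where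
  "inv_dist B1 B2 =
     (if \<exists>d. mobius_inv_dist B1 B2 d then (THE d. mobius_inv_dist B1 B2 d)
      else - (THE d. mobius_inv_dist (opposite_ball B1) B2 d))"

text \<open>
  The product of \<^term>\<open>BijGroup UNIV\<close> is composition only on bijections, so the following
  is what makes \<^const>\<open>mobius_group\<close> a group of maps under composition.
\<close>

lemma sphere_inversion_involution:
  fixes c :: "'a::euclidean_space"
  assumes "0 < r"
  shows "sphere_inversion c r (sphere_inversion c r p) = p"
proof (cases p)
  case None
  then show ?thesis by (simp add: sphere_inversion_def)
next
  case (Some x)
  show ?thesis
  proof (cases "x = c")
    case True
    with Some show ?thesis by (simp add: sphere_inversion_def)
  next
    case False
    define k where "k = r\<^sup>2 / (norm (x - c))\<^sup>2"
    have n: "norm (x - c) \<noteq> 0" using False by simp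
    have k: "k > 0" using assms n by (simp add: k_def)
    have "norm (k *\<^sub>R (x - c)) = k * norm (x - c)" using k by simp
    moreover have "r\<^sup>2 / (k * norm (x - c))\<^sup>2 * k = 1"
      using assms n by (simp add: k_def field_simps power2_eq_square)
    ultimately have "r\<^sup>2 / (norm (k *\<^sub>R (x - c)))\<^sup>2 * k = 1" by (simp only:)
    then have "c + (r\<^sup>2 / (norm (k *\<^sub>R (x - c)))\<^sup>2) *\<^sub>R (k *\<^sub>R (x - c)) = x"
      by (simp only: scaleR_scaleR) simp
    then show ?thesis using Some False k
      by (simp add: sphere_inversion_def flip: k_def)
  qed
qed

lemma plane_reflection_involution:
  fixes a :: "'a::euclidean_space"
  assumes "a \<noteq> 0"
  shows "plane_reflection a b (plane_reflection a b p) = p"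
  using assms
  by (cases p)
    (auto simp: plane_reflection_def inner_diff_right algebra_simps diff_divide_distrib
      simp flip: scaleR_add_left)

lemma inversions_subset_Bij: "inversions \<subseteq> Bij UNIV"
proof
  fix f :: "'a option \<Rightarrow> 'a option"
  assume "f \<in> inversions"
  then have "f (f p) = p" for p
    by (auto simp: inversions_def sphere_inversion_involution plane_reflection_involution)
  then have "bij f" by (metis bijI')
  then show "f \<in> Bij UNIV" by (simp add: Bij_def)
qed

end

theory Submission
  imports Defs
begin

text \<open>
  Lorentzian model.  On triples \<open>(b, a, c)\<close> take the form
  \<open>lor (b, a, c) (b', a', c') = b \<bullet> b' - a c' - c a'\<close> of signature \<open>(N + 1, 1)\<close>; the points of
  the extended space are its null lines, spanned by \<open>(x, 1, |x|\<^sup>2/2)\<close> and, for the point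
  at infinity, \<open>(0, 0, 1)\<close>.  An open ball is the set of points on the positive side of a unique
  vector \<open>v\<close> with \<open>lor v v = 1\<close>; its opposite belongs to \<open>- v\<close>, inversions act as reflections
  in such vectors, and the inversive distance of two balls is \<open>lor v w\<close>.  So condition (ii) is an
  equality of Gram matrices.

  The bounding spheres have no common point iff no null vector is orthogonal to all the \<open>v \<alpha>\<close>.
  Then the span \<open>V\<close> of the \<open>v \<alpha>\<close> is nondegenerate, so \<open>V\<close> or its orthogonal complement
  contains a timelike \<open>e\<close>.  Choose a matching timelike \<open>e'\<close> for the other family, replacing
  that family and \<open>e'\<close> by their negatives if \<open>e\<close> and \<open>e'\<close> lie in opposite cones (this is where
  opposite balls enter).  After \<open>e\<close> is moved to \<open>e'\<close>, each difference \<open>u - u'\<close> still to be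
  corrected is orthogonal to \<open>e'\<close>, hence spacelike, and reflecting in it is an inversion.
\<close>

section \<open>The Lorentz form\<close>

definition lor :: "'a::euclidean_space \<times> real \<times> real \<Rightarrow> 'a \<times> real \<times> real \<Rightarrow> real" where
  "lor v w = fst v \<bullet> fst w - fst (snd v) * snd (snd w) - snd (snd v) * fst (snd w)"

lemma lor_Pair: "lor (b, a, c) (b', a', c') = b \<bullet> b' - a * c' - c * a'"
  by (simp add: lor_def)

lemma lor_commute: "lor v w = lor w v"
  by (simp add: lor_def inner_commute)

lemma lor_add_left: "lor (u + v) w = lor u w + lor v w"
  and lor_add_right: "lor w (u + v) = lor w u + lor w v"
  and lor_diff_left: "lor (u - v) w = lor u w - lor v w"
  and lor_diff_right: "lor w (u - v) = lor w u - lor w v"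
  and lor_scaleR_left: "lor (k *\<^sub>R v) w = k * lor v w"
  and lor_scaleR_right: "lor w (k *\<^sub>R v) = k * lor w v"
  and lor_minus_left: "lor (- v) w = - lor v w"
  and lor_minus_right: "lor w (- v) = - lor w v"
  and lor_zero_left: "lor 0 w = 0"
  and lor_zero_right: "lor w 0 = 0"
  by (simp_all add: lor_def algebra_simps)

lemmas lor_simps = lor_add_left lor_add_right lor_diff_left lor_diff_right
  lor_scaleR_left lor_scaleR_right lor_minus_left lor_minus_right lor_zero_left lor_zero_right

lemma linear_lor: "linear (lor v)"
  by (intro linearI) (simp_all add: lor_simps)

text \<open>It turns \<open>lor\<close> into the Euclidean inner product, so that Euclidean facts
  about orthogonality and dimension carry over to \<open>lor\<close>.\<close>

definition lor_flip :: "'a::euclidean_space \<times> real \<times> real \<Rightarrow> 'a \<times> real \<times> real" where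
  "lor_flip v = (fst v, - snd (snd v), - fst (snd v))"

lemma lor_eq_inner: "lor v w = v \<bullet> lor_flip w"
  by (simp add: lor_def lor_flip_def inner_prod_def)

lemma lor_flip_flip [simp]: "lor_flip (lor_flip v) = v"
  by (simp add: lor_flip_def)

lemma linear_lor_flip: "linear lor_flip"
  by (intro linearI) (simp_all add: lor_flip_def)

lemma inj_lor_flip: "inj lor_flip"
  by (metis injI lor_flip_flip)

text \<open>For \<open>u = (b, a, c)\<close> and \<open>d = (b', a', c')\<close> the hypotheses read
  \<open>b \<bullet> b < 2 * (a * c)\<close> and \<open>b \<bullet> b' = a * c' + c * a'\<close>.
  Cauchy-Schwarz and \<open>4 * (a * c) * (a' * c') \<le> (a * c' + c * a')\<^sup>2\<close> then
  bound \<open>a' * c'\<close>, after cancelling the positive factor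
  \<open>2 * (a * c)\<close>.\<close>

lemma orthogonal_timelike_imp_spacelike:
  assumes u: "lor u u < 0" and ud: "lor u d = 0" and d: "d \<noteq> 0"
  shows "0 < lor d d"
proof -
  obtain b a c where u': "u = (b, a, c)" by (cases u)
  obtain b' a' c' where d': "d = (b', a', c')" by (cases d)
  have 1: "b \<bullet> b < 2 * (a * c)" using u by (simp add: u' lor_Pair)
  then have ac: "0 < a * c" using inner_ge_zero[of b] by linarith
  have 2: "b \<bullet> b' = a * c' + c * a'" using ud by (simp add: u' d' lor_Pair)
  have "2 * (a' * c') < b' \<bullet> b'"
  proof (cases "b' = 0")
    \<comment> \<open>Multiplying by \<open>b' \<bullet> b' = 0\<close> would lose strictness. Here
      orthogonality makes \<open>a * c'\<close> and \<open>c * a'\<close> opposite and nonzero while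
      \<open>a\<close> and \<open>c\<close> have the same sign.\<close>
    case True
    then have 3: "a * c' + c * a' = 0" using 2 by simp
    have "a' \<noteq> 0 \<or> c' \<noteq> 0" using d d' True by (auto simp: zero_prod_def)
    moreover have "a \<noteq> 0" "c \<noteq> 0" using ac by auto
    ultimately have "c' \<noteq> 0" using 3 by auto
    have "(a * c) * (a' * c') = a * c' * (c * a')" by simp
    also have "\<dots> = - (a * c')\<^sup>2" using 3 by (simp add: power2_eq_square add_eq_0_iff)
    also have "\<dots> < 0" using \<open>a \<noteq> 0\<close> \<open>c' \<noteq> 0\<close> by simp
    finally have "a' * c' < 0" using ac mult_nonneg_nonneg[of "a * c" "a' * c'"] by linarith
    with True show ?thesis by simp
  next
    case False
    then have "(b \<bullet> b) * (b' \<bullet> b') < 2 * (a * c) * (b' \<bullet> b')" using 1 by simp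
    moreover have "(a * c' + c * a')\<^sup>2 \<le> (b \<bullet> b) * (b' \<bullet> b')"
      using Cauchy_Schwarz_ineq[of b b'] 2 by simp
    moreover have "4 * (a * c) * (a' * c') \<le> (a * c' + c * a')\<^sup>2"
      using zero_le_power2[of "a * c' - c * a'"] by (simp add: power2_eq_square algebra_simps)
    ultimately have "(2 * (a * c)) * (2 * (a' * c')) < (2 * (a * c)) * (b' \<bullet> b')" by linarith
    moreover have "0 < 2 * (a * c)" using ac by linarith
    ultimately show ?thesis by (rule mult_less_cancel_left_pos[THEN iffD1, rotated])
  qed
  then show ?thesis by (simp add: d' lor_Pair algebra_simps)
qed

definition lor_reflection ::
    "'a::euclidean_space \<times> real \<times> real \<Rightarrow> 'a \<times> real \<times> real \<Rightarrow> 'a \<times> real \<times> real" where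
  "lor_reflection d v = v - (2 * lor v d / lor d d) *\<^sub>R d"

lemma linear_lor_reflection: "linear (lor_reflection d)"
  by (intro linearI)
    (simp_all add: lor_reflection_def lor_simps algebra_simps add_divide_distrib)

lemma lor_lor_reflection:
  assumes "lor d d \<noteq> 0"
  shows "lor (lor_reflection d v) (lor_reflection d w) = lor v w"
proof -
  define k l where "k = 2 * lor v d / lor d d" and "l = 2 * lor w d / lor d d"
  have "lor (v - k *\<^sub>R d) (w - l *\<^sub>R d) =
      lor v w - l * lor v d - k * lor w d + k * (l * lor d d)"
    by (simp add: lor_simps lor_commute[of d w] right_diff_distrib)
  also have "l * lor d d = 2 * lor w d" using assms by (simp add: l_def)
  also have "l * lor v d = k * lor w d" by (simp add: k_def l_def)
  finally show ?thesis by (simp add: lor_reflection_def k_def l_def)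
qed

lemma lor_reflection_scaleR: "k \<noteq> 0 \<Longrightarrow> lor_reflection (k *\<^sub>R d) = lor_reflection d"
  by (rule ext) (simp add: lor_reflection_def lor_simps)

lemma lor_reflection_orthogonal: "lor v d = 0 \<Longrightarrow> lor_reflection d v = v"
  by (simp add: lor_reflection_def)

text \<open>Equal norms make \<open>v - w\<close> orthogonal to \<open>v + w\<close>, so the mirror
  orthogonal to \<open>v - w\<close> exchanges \<open>v\<close> and \<open>w\<close>.\<close>

lemma lor_reflection_diff:
  assumes "lor v v = lor w w" "lor (v - w) (v - w) \<noteq> 0"
  shows "lor_reflection (v - w) v = w"
proof -
  have "2 * lor v (v - w) = lor (v - w) (v - w)"
    using assms(1) by (simp add: lor_simps lor_commute[of w v])
  with assms(2) show ?thesis by (simp add: lor_reflection_def)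
qed

definition pt :: "'a::euclidean_space option \<Rightarrow> 'a \<times> real \<times> real" where
  "pt p = (case p of None \<Rightarrow> (0, 0, 1) | Some x \<Rightarrow> (x, 1, (norm x)\<^sup>2 / 2))"

lemma pt_simps [simp]: "pt None = (0, 0, 1)" "pt (Some x) = (x, 1, (norm x)\<^sup>2 / 2)"
  by (simp_all add: pt_def)

text \<open>A nonzero middle coordinate can be scaled to 1. If it is 0, nullity forces the first
  coordinate to vanish, which leaves the line of infinity. The factor \<open>k\<close> may be
  negative.\<close>

lemma null_vector_eq_pt:
  assumes "lor n n = 0" "n \<noteq> 0"
  obtains k p where "k \<noteq> 0" "n = k *\<^sub>R pt p"
proof -
  obtain b a c where n: "n = (b, a, c)" by (cases n)
  have q: "b \<bullet> b = 2 * (a * c)" using assms(1) by (simp add: n lor_Pair)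
  show thesis
  proof (cases "a = 0")
    case True
    with q n assms(2) have "c \<noteq> 0" "n = c *\<^sub>R pt None" by (auto simp: zero_prod_def)
    with that show thesis by blast
  next
    case False
    have "n = a *\<^sub>R pt (Some (b /\<^sub>R a))"
      using False q by (simp add: n power_mult_distrib power2_norm_eq_inner del: norm_scaleR)
    with False that show thesis by blast
  qed
qed

section \<open>Inversions as Lorentz reflections\<close>

text \<open>The action on null lines cannot tell \<open>T\<close> from \<open>- T\<close>. Requiring
  \<open>k > 0\<close> fixes the sign, so that \<open>T\<close> carries sides to sides and not to
  their opposites.\<close>

definition represents ::
    "('a::euclidean_space option \<Rightarrow> 'a option) \<Rightarrow>
     ('a \<times> real \<times> real \<Rightarrow> 'a \<times> real \<times> real) \<Rightarrow> bool" where
  "represents f T \<longleftrightarrow> bij f \<and> linear T \<and> (\<forall>v w. lor (T v) (T w) = lor v w) \<and>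
     (\<forall>p. \<exists>k>0. pt (f p) = k *\<^sub>R T (pt p))"

lemma represents_id: "represents id id"
  unfolding represents_def by (auto intro!: exI[of _ 1] linear_id)

lemma represents_comp:
  assumes "represents f S" "represents g T"
  shows "represents (f \<circ> g) (S \<circ> T)"
  unfolding represents_def
proof (intro conjI allI)
  show "bij (f \<circ> g)" "linear (S \<circ> T)"
    using assms by (auto simp: represents_def bij_comp linear_compose)
  show "lor ((S \<circ> T) v) ((S \<circ> T) w) = lor v w" for v w
    using assms unfolding represents_def comp_def by (metis (no_types))
  fix p
  obtain k where "k > 0" "pt (g p) = k *\<^sub>R T (pt p)" using assms(2) unfolding represents_def by blast
  moreover obtain l where "l > 0" "pt (f (g p)) = l *\<^sub>R S (pt (g p))"
    using assms(1) unfolding represents_def by blast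
  moreover have "linear S" using assms(1) by (simp add: represents_def)
  ultimately show "\<exists>k>0. pt ((f \<circ> g) p) = k *\<^sub>R (S \<circ> T) (pt p)"
    by (intro exI[of _ "l * k"]) (simp add: linear_cmul)
qed

text \<open>For \<open>0 < r\<close> this is scaled to be a unit vector and signed so that its
  product with \<open>pt (Some x)\<close> is positive exactly for \<open>x\<close> inside the
  ball.\<close>

definition ball_vec :: "'a::euclidean_space \<Rightarrow> real \<Rightarrow> 'a \<times> real \<times> real" where
  "ball_vec c r = (c /\<^sub>R r, 1 / r, ((norm c)\<^sup>2 - r\<^sup>2) / (2 * r))"

text \<open>No normalisation of \<open>a\<close> is built in, since reflections do not depend on the
  length of the vector.\<close>

definition plane_vec :: "'a::euclidean_space \<Rightarrow> real \<Rightarrow> 'a \<times> real \<times> real" where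
  "plane_vec a b = (a, 0, b)"

lemma lor_ball_vec:
  assumes "0 < r" "0 < s"
  shows "lor (ball_vec c r) (ball_vec d s) = (r\<^sup>2 + s\<^sup>2 - (norm (c - d))\<^sup>2) / (2 * r * s)"
proof -
  have "(norm (c - d))\<^sup>2 = (norm c)\<^sup>2 - 2 * (c \<bullet> d) + (norm d)\<^sup>2"
    unfolding power2_norm_eq_inner by (simp add: inner_diff inner_commute)
  with assms show ?thesis
    by (simp add: ball_vec_def lor_Pair) (simp add: field_simps power2_eq_square)
qed

lemma lor_ball_vec_self: "0 < r \<Longrightarrow> lor (ball_vec c r) (ball_vec c r) = 1"
  by (simp add: lor_ball_vec power2_eq_square)

lemma lor_ball_vec_Some:
  assumes "0 < r"
  shows "lor (ball_vec c r) (pt (Some x)) = (r\<^sup>2 - (norm (x - c))\<^sup>2) / (2 * r)"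
proof -
  have "(norm (x - c))\<^sup>2 = (norm x)\<^sup>2 - 2 * (c \<bullet> x) + (norm c)\<^sup>2"
    unfolding power2_norm_eq_inner by (simp add: inner_diff inner_commute)
  with assms show ?thesis
    by (simp add: ball_vec_def lor_Pair) (simp add: field_simps power2_eq_square)
qed

lemma lor_ball_vec_None: "lor (ball_vec c r) (pt None) = - 1 / r"
  by (simp add: ball_vec_def lor_Pair)

lemma lor_plane_vec_Some: "lor (plane_vec a b) (pt (Some x)) = a \<bullet> x - b"
  by (simp add: plane_vec_def lor_Pair)

lemma lor_plane_vec_None: "lor (plane_vec a b) (pt None) = 0"
  by (simp add: plane_vec_def lor_Pair)

text \<open>The sign of the middle coordinate decides: it is \<open>1 / r\<close> for a ball,
  \<open>- 1 / r\<close> for an exterior and 0 for a half-space. The unit condition then fixes the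
  last coordinate, or makes the normal of the half-space a unit vector.\<close>

lemma unit_vector_cases:
  assumes "lor v v = 1"
  obtains (ball) c r where "0 < r" "v = ball_vec c r"
    | (coball) c r where "0 < r" "v = - ball_vec c r"
    | (plane) a b where "norm a = 1" "v = plane_vec a b"
proof -
  obtain b a c where v: "v = (b, a, c)" by (cases v)
  have q: "b \<bullet> b = 1 + 2 * (a * c)" using assms by (simp add: v lor_Pair)
  consider "a > 0" | "a = 0" | "a < 0" by linarith
  then show thesis
  proof cases
    case 1
    then have "v = ball_vec (b /\<^sub>R a) (1 / a)"
      using q by (simp add: v ball_vec_def power_mult_distrib power2_norm_eq_inner del: norm_scaleR)
        (simp add: field_simps power2_eq_square)
    with 1 ball[of "1 / a"] show thesis by simp
  next
    case 2
    then show thesis using plane[of b c] q by (simp add: v plane_vec_def norm_eq_1)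
  next
    case 3
    then have "v = - ball_vec (b /\<^sub>R a) (- 1 / a)"
      using q by (simp add: v ball_vec_def power_mult_distrib power2_norm_eq_inner del: norm_scaleR)
        (simp add: field_simps power2_eq_square)
    with 3 coball[of "- 1 / a"] show thesis by (simp add: divide_neg_neg)
  qed
qed

text \<open>The scale \<open>k\<close> is found by comparing one normalised coordinate: the middle
  one if the image is finite, the last one if it is infinity.\<close>

lemma represents_sphere_inversion:
  assumes "0 < r"
  shows "represents (sphere_inversion c r) (lor_reflection (ball_vec c r))"
  unfolding represents_def
proof (intro conjI allI)
  show "bij (sphere_inversion c r)"
    using sphere_inversion_involution[OF assms] by (metis bijI')
  show "linear (lor_reflection (ball_vec c r))" by (rule linear_lor_reflection)
  show "lor (lor_reflection (ball_vec c r) v) (lor_reflection (ball_vec c r) w) = lor v w" for v w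
    using assms by (intro lor_lor_reflection) (simp add: lor_ball_vec_self)
  fix p :: "'a option"
  have R: "lor_reflection (ball_vec c r) (pt p) =
      pt p - (2 * lor (ball_vec c r) (pt p)) *\<^sub>R ball_vec c r" for p
    using assms by (simp add: lor_reflection_def lor_ball_vec_self lor_commute)
  show "\<exists>k>0. pt (sphere_inversion c r p) = k *\<^sub>R lor_reflection (ball_vec c r) (pt p)"
  proof (cases p)
    case None
    have "(r\<^sup>2 / 2) *\<^sub>R (pt None + (2 / r) *\<^sub>R ball_vec c r) = pt (Some c)"
      using assms by (simp add: ball_vec_def) (simp add: field_simps power2_eq_square)
    with assms None show ?thesis unfolding R None lor_ball_vec_None
      by (intro exI[of _ "r\<^sup>2 / 2"]) (simp add: sphere_inversion_def del: pt_simps)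
  next
    case (Some x)
    show ?thesis
    proof (cases "x = c")
      case True
      have "(2 / r\<^sup>2) *\<^sub>R (pt (Some c) - r *\<^sub>R ball_vec c r) = pt None"
        using assms by (simp add: ball_vec_def) (simp add: field_simps power2_eq_square)
      moreover have "2 * lor (ball_vec c r) (pt (Some c)) = r"
        using assms by (simp add: lor_ball_vec_Some power2_eq_square del: pt_simps)
      ultimately show ?thesis using assms unfolding R Some True
        by (intro exI[of _ "2 / r\<^sup>2"]) (simp add: sphere_inversion_def del: pt_simps)
    next
      case False
      \<comment> \<open>The squared distance \<open>D\<close> eliminates \<open>norm x\<close>; what
        remains is a rational identity in each coordinate.\<close>
      define D where "D = (norm (x - c))\<^sup>2"
      have D: "D > 0" using False by (simp add: D_def)
      have xx: "(norm x)\<^sup>2 = D + 2 * (c \<bullet> x) - (norm c)\<^sup>2"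
        by (simp add: D_def power2_norm_eq_inner inner_diff inner_commute)
      have n: "(norm (c + k *\<^sub>R (x - c)))\<^sup>2 =
          (norm c)\<^sup>2 + 2 * k * (c \<bullet> x - (norm c)\<^sup>2) + k\<^sup>2 * D" for k
        unfolding D_def power2_norm_eq_inner
        by (simp add: inner_add inner_diff inner_commute power2_eq_square algebra_simps)
      have k: "2 * (y / (2 * r)) = y / r" for y by simp
      have "pt (Some (c + (r\<^sup>2 / D) *\<^sub>R (x - c))) =
          (r\<^sup>2 / D) *\<^sub>R (pt (Some x) - ((r\<^sup>2 - D) / r) *\<^sub>R ball_vec c r)"
      proof -
        have s1: "c + (r\<^sup>2 / D) *\<^sub>R (x - c) = (r\<^sup>2 / D) *\<^sub>R (x - ((r\<^sup>2 - D) / r) *\<^sub>R (c /\<^sub>R r))"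
        proof -
          have "(r\<^sup>2 / D) * ((r\<^sup>2 - D) / r * inverse r) = r\<^sup>2 / D - 1"
            using assms D by (simp add: field_simps power2_eq_square)
          then show ?thesis by (simp add: scaleR_diff_right scaleR_diff_left)
        qed
        have s2: "1 = (r\<^sup>2 / D) * (1 - (r\<^sup>2 - D) / r * (1 / r))"
          using assms D by (simp add: field_simps power2_eq_square)
        have s3: "(norm (c + (r\<^sup>2 / D) *\<^sub>R (x - c)))\<^sup>2 / 2 =
           (r\<^sup>2 / D) * ((norm x)\<^sup>2 / 2 - (r\<^sup>2 - D) / r * (((norm c)\<^sup>2 - r\<^sup>2) / (2 * r)))"
          unfolding n xx using assms D by (simp add: field_simps power2_eq_square)
        from s1 s2 s3 show ?thesis
          unfolding pt_simps ball_vec_def scaleR_Pair diff_Pair prod.inject real_scaleR_def by blast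
      qed
      moreover have "sphere_inversion c r (Some x) = Some (c + (r\<^sup>2 / D) *\<^sub>R (x - c))"
        using False by (simp add: sphere_inversion_def D_def)
      moreover have "r\<^sup>2 / D > 0" using assms D by simp
      ultimately show ?thesis
        unfolding R Some lor_ball_vec_Some[OF assms] D_def[symmetric] k
        by (intro exI[of _ "r\<^sup>2 / D"]) (simp del: pt_simps)
    qed
  qed
qed

text \<open>The middle coordinate of \<open>plane_vec\<close> is 0, so the reflection keeps points
  normalised and \<open>k = 1\<close> works throughout.\<close>

lemma represents_plane_reflection:
  assumes "a \<noteq> 0"
  shows "represents (plane_reflection a b) (lor_reflection (plane_vec a b))"
  unfolding represents_def
proof (intro conjI allI)
  have q: "lor (plane_vec a b) (plane_vec a b) = a \<bullet> a"
    by (simp add: plane_vec_def lor_Pair)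
  show "bij (plane_reflection a b)"
    using plane_reflection_involution[OF assms] by (metis bijI')
  show "linear (lor_reflection (plane_vec a b))" by (rule linear_lor_reflection)
  show "lor (lor_reflection (plane_vec a b) v) (lor_reflection (plane_vec a b) w) = lor v w" for v w
    using assms by (intro lor_lor_reflection) (simp add: q)
  fix p :: "'a option"
  have R: "lor_reflection (plane_vec a b) (pt p) =
      pt p - (2 * lor (plane_vec a b) (pt p) / (a \<bullet> a)) *\<^sub>R plane_vec a b" for p
    by (simp add: lor_reflection_def q lor_commute)
  show "\<exists>k>0. pt (plane_reflection a b p) = k *\<^sub>R lor_reflection (plane_vec a b) (pt p)"
  proof (cases p)
    case None
    then show ?thesis unfolding R None lor_plane_vec_None
      by (intro exI[of _ 1]) (simp add: plane_reflection_def)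
  next
    case (Some x)
    define k where "k = 2 * (a \<bullet> x - b) / (a \<bullet> a)"
    have k: "k * (a \<bullet> a) = 2 * (a \<bullet> x - b)" using assms by (simp add: k_def)
    have "(norm (x - k *\<^sub>R a))\<^sup>2 = (norm x)\<^sup>2 - 2 * k * (a \<bullet> x) + k * (k * (a \<bullet> a))"
      unfolding power2_norm_eq_inner by (simp add: inner_diff inner_commute)
    also have "\<dots> = (norm x)\<^sup>2 - 2 * (k * b)" unfolding k by (simp add: algebra_simps)
    finally show ?thesis unfolding R Some lor_plane_vec_Some k_def[symmetric]
      by (intro exI[of _ 1])
        (simp add: plane_reflection_def plane_vec_def k_def[symmetric] del: right_diff_distrib_numeral)
  qed
qed

section \<open>The Moebius group acting by Lorentz isometries\<close>

definition mobius_isometries :: "('a::euclidean_space \<times> real \<times> real \<Rightarrow> 'a \<times> real \<times> real) set" where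
  "mobius_isometries = {T. \<exists>f\<in>mobius_group. represents f T}"

lemma sphere_inversion_in_inversions: "0 < r \<Longrightarrow> sphere_inversion c r \<in> inversions"
  and plane_reflection_in_inversions: "a \<noteq> 0 \<Longrightarrow> plane_reflection a b \<in> inversions"
  by (auto simp: inversions_def)

lemma inversions_subset_carrier: "inversions \<subseteq> carrier (BijGroup UNIV)"
  using inversions_subset_Bij by (simp add: BijGroup_def)

lemma mult_BijGroup_UNIV:
  assumes "f \<in> carrier (BijGroup UNIV)" "g \<in> carrier (BijGroup UNIV)"
  shows "f \<otimes>\<^bsub>BijGroup UNIV\<^esub> g = f \<circ> g"
  using assms by (simp add: BijGroup_def compose_def comp_def fun_eq_iff)

lemma one_BijGroup_UNIV: "\<one>\<^bsub>BijGroup UNIV\<^esub> = id"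
  by (simp add: BijGroup_def fun_eq_iff)

lemma inversion_involution: "h \<in> inversions \<Longrightarrow> h \<circ> h = id"
  by (auto simp: inversions_def fun_eq_iff sphere_inversion_involution plane_reflection_involution)

lemma inv_inversion:
  assumes "h \<in> inversions"
  shows "inv\<^bsub>BijGroup UNIV\<^esub> h = h"
proof -
  interpret group "BijGroup UNIV" by (rule group_BijGroup)
  have h: "h \<in> carrier (BijGroup UNIV)" using assms inversions_subset_carrier by blast
  then show ?thesis
    using inversion_involution[OF assms]
    by (intro inv_equality) (simp_all add: mult_BijGroup_UNIV one_BijGroup_UNIV)
qed

text \<open>Inversions are their own inverses, so inverses of generators need no separate case. The
  disjunction for \<open>h\<close> serves both a single generator, taken with \<open>g = id\<close>,
  and a product of two group elements.\<close>

lemma mobius_group_induct [consumes 1, case_names id comp]: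
  assumes "f \<in> mobius_group"
    and "P id"
    and "\<And>h g. h \<in> inversions \<or> h \<in> mobius_group \<and> P h \<Longrightarrow> g \<in> mobius_group \<Longrightarrow> P g \<Longrightarrow> P (h \<circ> g)"
  shows "P f"
proof -
  interpret group "BijGroup UNIV :: ('a option \<Rightarrow> 'a option) monoid" by (rule group_BijGroup)
  have inv: "P h" if "h \<in> inversions" for h
    using assms(3)[of h id] assms(2) that generate.one[of "BijGroup UNIV" inversions]
    by (simp add: mobius_group_def one_BijGroup_UNIV)
  from assms(1) show ?thesis unfolding mobius_group_def
  proof (induction rule: generate.induct)
    case one
    then show ?case unfolding one_BijGroup_UNIV by (rule assms(2))
  next
    case (incl h)
    then show ?case by (rule inv)
  next
    case (inv h)
    then show ?case using \<open>\<And>h. h \<in> inversions \<Longrightarrow> P h\<close> by (simp add: inv_inversion)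
  next
    case (eng h g)
    then have "h \<in> carrier (BijGroup UNIV)" "g \<in> carrier (BijGroup UNIV)"
      using generate_in_carrier[OF inversions_subset_carrier] by blast+
    then have "h \<otimes>\<^bsub>BijGroup UNIV\<^esub> g = h \<circ> g" by (rule mult_BijGroup_UNIV)
    with eng assms(3)[of h g] show ?case unfolding mobius_group_def by metis
  qed
qed

lemma id_in_mobius_group: "id \<in> mobius_group"
  unfolding mobius_group_def one_BijGroup_UNIV[symmetric] by (rule generate.one)

lemma inversion_in_mobius_group: "h \<in> inversions \<Longrightarrow> h \<in> mobius_group"
  unfolding mobius_group_def by (rule generate.incl)

lemma comp_in_mobius_group:
  assumes "f \<in> mobius_group" "g \<in> mobius_group"
  shows "f \<circ> g \<in> mobius_group"
proof -
  interpret group "BijGroup UNIV :: ('a option \<Rightarrow> 'a option) monoid" by (rule group_BijGroup)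
  have "f \<in> carrier (BijGroup UNIV)" "g \<in> carrier (BijGroup UNIV)"
    using assms generate_in_carrier[OF inversions_subset_carrier] by (auto simp: mobius_group_def)
  then show ?thesis
    using generate.eng[of f "BijGroup UNIV" inversions g] assms
    by (simp add: mult_BijGroup_UNIV mobius_group_def)
qed

lemma inversion_represented:
  assumes "h \<in> inversions"
  obtains T where "represents h T"
  using assms represents_sphere_inversion represents_plane_reflection
  unfolding inversions_def by blast

lemma mobius_represented:
  assumes "f \<in> mobius_group"
  shows "\<exists>T. represents f T"
  using assms
proof (induction rule: mobius_group_induct)
  case id
  then show ?case using represents_id by blast
next
  case (comp h g)
  then show ?case using represents_comp inversion_represented by metis
qed

lemma id_in_mobius_isometries: "id \<in> mobius_isometries"
  using id_in_mobius_group represents_id by (auto simp: mobius_isometries_def)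

lemma comp_in_mobius_isometries:
  "S \<in> mobius_isometries \<Longrightarrow> T \<in> mobius_isometries \<Longrightarrow> S \<circ> T \<in> mobius_isometries"
  unfolding mobius_isometries_def using comp_in_mobius_group represents_comp by blast

lemma lor_mobius_isometry:
  "T \<in> mobius_isometries \<Longrightarrow> lor (T v) (T w) = lor v w"
  unfolding mobius_isometries_def represents_def by blast

lemma linear_mobius_isometry: "T \<in> mobius_isometries \<Longrightarrow> linear T"
  unfolding mobius_isometries_def represents_def by blast

text \<open>Scaling \<open>d\<close> to a unit vector does not change the reflection, and a unit
  vector belongs to a ball, an exterior or a half-space. An exterior gives the same reflection as
  its ball.\<close>

lemma lor_reflection_in_mobius_isometries:
  assumes "0 < lor d d"
  shows "lor_reflection d \<in> mobius_isometries"
proof -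
  define k where "k = 1 / sqrt (lor d d)"
  have k: "k \<noteq> 0" "k * (k * lor d d) = 1"
    using assms by (simp_all add: k_def)
  then have "lor (k *\<^sub>R d) (k *\<^sub>R d) = 1" by (simp add: lor_simps)
  then have "\<exists>h\<in>inversions. represents h (lor_reflection (k *\<^sub>R d))"
  proof (cases rule: unit_vector_cases)
    case (ball c r)
    with represents_sphere_inversion[of r c] sphere_inversion_in_inversions[of r c]
    show ?thesis by auto
  next
    case (coball c r)
    have "lor_reflection (- ball_vec c r) = lor_reflection (ball_vec c r)"
      using lor_reflection_scaleR[of "-1" "ball_vec c r"] by simp
    with coball represents_sphere_inversion[of r c] sphere_inversion_in_inversions[of r c]
    show ?thesis by auto
  next
    case (plane a b)
    then have "a \<noteq> 0" by auto
    with plane represents_plane_reflection[of a b] plane_reflection_in_inversions[of a b]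
    show ?thesis by auto
  qed
  then show ?thesis
    unfolding lor_reflection_scaleR[OF k(1)] mobius_isometries_def
    using inversion_in_mobius_group by blast
qed

text \<open>An extension argument in the style of Witt: match \<open>e\<close> with
  \<open>e'\<close> first, then the \<open>u i\<close> one at a time, each by a single reflection
  that fixes everything already matched.\<close>

lemma isometry_extension:
  fixes u u' :: "'i \<Rightarrow> 'a::euclidean_space \<times> real \<times> real"
  assumes "finite I"
    and e: "lor e e < 0" "lor e' e' = lor e e" "lor e e' < 0"
    and eu: "\<And>i. i \<in> I \<Longrightarrow> lor e' (u' i) = lor e (u i)"
    and uu: "\<And>i j. i \<in> I \<Longrightarrow> j \<in> I \<Longrightarrow> lor (u' i) (u' j) = lor (u i) (u j)"
  shows "\<exists>T\<in>mobius_isometries. T e = e' \<and> (\<forall>i\<in>I. T (u i) = u' i)"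
  using assms(1) eu uu
proof (induction I rule: finite_induct)
  case empty
  show ?case
  proof (cases "e = e'")
    case True
    then show ?thesis using id_in_mobius_isometries by (intro bexI[of _ id]) auto
  next
    case False
    have "0 < lor (e - e') (e - e')"
    proof (rule orthogonal_timelike_imp_spacelike)
      \<comment> \<open>This is where \<open>lor e e' < 0\<close> enters: the sum of two timelike
        vectors in the same cone is timelike.\<close>
      show "lor (e + e') (e + e') < 0"
        using e by (simp add: lor_simps lor_commute[of e' e])
      show "lor (e + e') (e - e') = 0"
        using e by (simp add: lor_simps lor_commute[of e' e])
    qed (use False in simp)
    then show ?thesis
      using lor_reflection_in_mobius_isometries[of "e - e'"] lor_reflection_diff[of e e'] e
      by (intro bexI[of _ "lor_reflection (e - e')"]) auto
  qed
next
  case (insert j I)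
  then obtain T where T: "T \<in> mobius_isometries" "T e = e'" "\<And>i. i \<in> I \<Longrightarrow> T (u i) = u' i"
    by auto
  show ?case
  proof (cases "T (u j) = u' j")
    case True
    with T show ?thesis by auto
  next
    case False
    \<comment> \<open>Equality of products makes this error orthogonal to \<open>e'\<close> and to
      every \<open>u' i\<close> already reached, so it is spacelike and its reflection disturbs none
      of them.\<close>
    define d where "d = T (u j) - u' j"
    have Tj: "lor (T (u j)) (T v) = lor (u j) v" for v
      by (rule lor_mobius_isometry[OF T(1)])
    have de: "lor e' d = 0"
      using insert.prems(1)[of j] Tj[of e] T(2)
      by (simp add: d_def lor_simps lor_commute)
    have di: "lor (u' i) d = 0" if "i \<in> I" for i
      using insert.prems(2)[of i j] Tj[of "u i"] T(3)[OF that] that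
      by (simp add: d_def lor_simps lor_commute)
    have dd: "0 < lor d d"
      using orthogonal_timelike_imp_spacelike[OF _ de] e False by (simp add: d_def)
    let ?R = "lor_reflection d"
    have "?R (T (u j)) = u' j"
      unfolding d_def using dd insert.prems(2)[of j j] Tj[of "u j"]
      by (intro lor_reflection_diff) (auto simp: d_def)
    moreover have "?R (T e) = e'" using T(2) de by (simp add: lor_reflection_orthogonal)
    moreover have "?R (T (u i)) = u' i" if "i \<in> I" for i
      using T(3)[OF that] di[OF that] by (simp add: lor_reflection_orthogonal)
    moreover have "?R \<circ> T \<in> mobius_isometries"
      by (intro comp_in_mobius_isometries lor_reflection_in_mobius_isometries dd T)
    ultimately show ?thesis by (intro bexI[of _ "?R \<circ> T"]) auto
  qed
qed

section \<open>Balls as sides of unit vectors\<close>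

definition side :: "'a::euclidean_space \<times> real \<times> real \<Rightarrow> 'a option set" where
  "side v = {p. 0 < lor v (pt p)}"

definition zero_set :: "'a::euclidean_space \<times> real \<times> real \<Rightarrow> 'a option set" where
  "zero_set v = {p. lor v (pt p) = 0}"

text \<open>The product with \<open>pt p\<close> is preserved up to the positive factor
  \<open>k\<close>, hence its sign is preserved.\<close>

lemma represents_image_side:
  assumes "represents f T"
  shows "f ` side v = side (T v)"
proof -
  have "p \<in> side v \<longleftrightarrow> f p \<in> side (T v)" for p
  proof -
    obtain k where "k > 0" "pt (f p) = k *\<^sub>R T (pt p)"
      using assms unfolding represents_def by blast
    moreover have "lor (T v) (T (pt p)) = lor v (pt p)"
      using assms unfolding represents_def by blast
    ultimately show ?thesis by (simp add: side_def lor_simps zero_less_mult_iff)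
  qed
  moreover have "surj f" using assms by (simp add: represents_def bij_def)
  ultimately show ?thesis using surj_image_vimage_eq[of f "side (T v)"]
    by (metis subset_antisym subsetI vimage_eq)
qed

lemma side_ball_vec:
  assumes "0 < r"
  shows "side (ball_vec c r) = Some ` ball c r"
proof (rule Set.set_eqI)
  fix p
  show "p \<in> side (ball_vec c r) \<longleftrightarrow> p \<in> Some ` ball c r"
  proof (cases p)
    case None
    with assms show ?thesis by (auto simp: side_def lor_ball_vec_None simp del: pt_simps)
  next
    case (Some x)
    have "(norm (x - c))\<^sup>2 < r\<^sup>2 \<longleftrightarrow> norm (x - c) < r"
      using assms by (metis abs_norm_cancel abs_of_pos abs_square_less_1 power2_less_imp_less
        power_strict_mono norm_ge_zero less_imp_le zero_less_numeral)
    with assms Some show ?thesis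
      by (auto simp: side_def lor_ball_vec_Some zero_less_divide_iff dist_norm norm_minus_commute
          simp del: pt_simps)
  qed
qed

lemma side_minus_ball_vec:
  assumes "0 < r"
  shows "side (- ball_vec c r) = - (Some ` cball c r)"
proof (rule Set.set_eqI)
  fix p
  show "p \<in> side (- ball_vec c r) \<longleftrightarrow> p \<in> - (Some ` cball c r)"
  proof (cases p)
    case None
    with assms show ?thesis by (auto simp: side_def lor_simps lor_ball_vec_None simp del: pt_simps)
  next
    case (Some x)
    have "r\<^sup>2 < (norm (x - c))\<^sup>2 \<longleftrightarrow> r < norm (x - c)"
      using assms by (meson norm_ge_zero power2_less_imp_less power_strict_mono less_imp_le zero_less_numeral)
    with assms Some show ?thesis
      by (auto simp: side_def lor_simps lor_ball_vec_Some divide_less_0_iff dist_norm norm_minus_commute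
          simp del: pt_simps)
  qed
qed

lemma side_plane_vec: "side (plane_vec a b) = Some ` {x. b < a \<bullet> x}"
proof (rule Set.set_eqI)
  fix p
  show "p \<in> side (plane_vec a b) \<longleftrightarrow> p \<in> Some ` {x. b < a \<bullet> x}"
    by (cases p) (auto simp: side_def lor_plane_vec_None lor_plane_vec_Some simp del: pt_simps)
qed

lemma zero_set_ball_vec:
  assumes "0 < r"
  shows "zero_set (ball_vec c r) = euclidean_sphere c r"
proof (rule Set.set_eqI)
  fix p
  show "p \<in> zero_set (ball_vec c r) \<longleftrightarrow> p \<in> euclidean_sphere c r"
    using assms
    by (cases p) (auto simp: zero_set_def euclidean_sphere_def lor_ball_vec_None lor_ball_vec_Some
        dist_norm norm_minus_commute simp del: pt_simps)
qed

lemma zero_set_plane_vec: "zero_set (plane_vec a b) = extended_plane a b"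
proof (rule Set.set_eqI)
  fix p
  show "p \<in> zero_set (plane_vec a b) \<longleftrightarrow> p \<in> extended_plane a b"
    by (cases p) (auto simp: zero_set_def extended_plane_def lor_plane_vec_None lor_plane_vec_Some
        simp del: pt_simps)
qed

lemma zero_set_minus: "zero_set (- v) = zero_set v"
  by (simp add: zero_set_def lor_simps)

lemma zero_set_scaleR: "k \<noteq> 0 \<Longrightarrow> zero_set (k *\<^sub>R v) = zero_set v"
  by (simp add: zero_set_def lor_simps)

lemma Compl_zero_set: "- zero_set v = side v \<union> side (- v)"
  by (auto simp: zero_set_def side_def lor_simps)

lemma side_Int_side_minus: "side v \<inter> side (- v) = {}"
  by (auto simp: side_def lor_simps)

lemma ext_spheres_eq_zero_sets: "ext_spheres = {zero_set v | v. lor v v = 1}"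
proof (intro equalityI subsetI)
  fix S :: "'a option set"
  assume "S \<in> ext_spheres"
  then consider c r where "0 < r" "S = euclidean_sphere c r" | a b where "a \<noteq> 0" "S = extended_plane a b"
    by (auto simp: ext_spheres_def)
  then show "S \<in> {zero_set v | v. lor v v = 1}"
  proof cases
    case 1
    then show ?thesis using zero_set_ball_vec lor_ball_vec_self by blast
  next
    case 2
    define v where "v = (1 / norm a) *\<^sub>R plane_vec a b"
    have "lor v v = 1" using 2
      by (simp add: v_def lor_simps) (simp add: plane_vec_def lor_Pair power2_norm_eq_inner[symmetric] power2_eq_square)
    moreover have "S = zero_set v"
      using 2 by (simp add: v_def zero_set_scaleR zero_set_plane_vec)
    ultimately show ?thesis by blast
  qed
next
  fix S :: "'a option set"
  assume "S \<in> {zero_set v | v. lor v v = 1}"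
  then obtain v where v: "S = zero_set v" "lor v v = 1" by blast
  from v(2) show "S \<in> ext_spheres"
  proof (cases rule: unit_vector_cases)
    case (ball c r)
    with v show ?thesis by (auto simp: ext_spheres_def zero_set_ball_vec)
  next
    case (coball c r)
    with v show ?thesis by (auto simp: ext_spheres_def zero_set_minus zero_set_ball_vec)
  next
    case (plane a b)
    then have "a \<noteq> 0" by auto
    with plane v show ?thesis by (auto simp: ext_spheres_def zero_set_plane_vec)
  qed
qed

section \<open>Uniqueness of the unit vector of a ball\<close>

text \<open>If the normals differ, a far point in direction \<open>a - a'\<close> lies in the first
  half-space and outside the second. Once they agree, the boundary points
  \<open>b *\<^sub>R a\<close> and \<open>b' *\<^sub>R a\<close> compare the offsets.\<close>

lemma halfspace_eq_imp:
  fixes a a' :: "'a::euclidean_space"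
  assumes "norm a = 1" "norm a' = 1" and eq: "{x. b < a \<bullet> x} = {x. b' < a' \<bullet> x}"
  shows "a = a' \<and> b = b'"
proof -
  have aa: "a \<bullet> a = 1" "a' \<bullet> a' = 1" using assms by (simp_all add: norm_eq_1)
  have iff: "b < a \<bullet> x \<longleftrightarrow> b' < a' \<bullet> x" for x using eq by blast
  have "a = a'"
  proof (rule ccontr)
    assume "a \<noteq> a'"
    then have "0 < (a - a') \<bullet> (a - a')" by simp
    then have p: "0 < 1 - a \<bullet> a'" using aa by (simp add: inner_diff inner_commute)
    define t where "t = (\<bar>b\<bar> + \<bar>b'\<bar> + 1) / (1 - a \<bullet> a')"
    have t: "t * (1 - a \<bullet> a') = \<bar>b\<bar> + \<bar>b'\<bar> + 1" using p by (simp add: t_def)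
    have "a \<bullet> (t *\<^sub>R (a - a')) = t * (1 - a \<bullet> a')"
      "a' \<bullet> (t *\<^sub>R (a - a')) = - (t * (1 - a \<bullet> a'))"
      using aa by (simp_all add: inner_diff inner_commute algebra_simps)
    with iff[of "t *\<^sub>R (a - a')"] show False unfolding t by linarith
  qed
  moreover have "b = b'"
    using iff[of "b *\<^sub>R a"] iff[of "b' *\<^sub>R a"] aa \<open>a = a'\<close> by (auto simp: not_less)
  ultimately show ?thesis by simp
qed

lemma ball_neq_halfspace:
  fixes a :: "'a::euclidean_space"
  assumes "norm a = 1"
  shows "ball c r \<noteq> {x. b < a \<bullet> x}"
proof
  assume eq: "ball c r = {x. b < a \<bullet> x}"
  define t where "t = \<bar>b\<bar> + \<bar>r\<bar> + \<bar>a \<bullet> c\<bar> + 1"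
  have aa: "a \<bullet> a = 1" using assms by (simp add: norm_eq_1)
  then have "t *\<^sub>R a \<in> {x. b < a \<bullet> x}" by (simp add: t_def)
  then have "norm (t *\<^sub>R a - c) < r" unfolding eq[symmetric] by (simp add: dist_norm norm_minus_commute)
  moreover have "\<bar>a \<bullet> (t *\<^sub>R a - c)\<bar> \<le> norm (t *\<^sub>R a - c)"
    using Cauchy_Schwarz_ineq2[of a "t *\<^sub>R a - c"] assms by simp
  ultimately show False using aa by (simp add: inner_diff t_def)
qed

text \<open>Infinity separates exteriors from balls and half-spaces, and unboundedness separates
  half-spaces from balls; within each kind the set determines its parameters. The definite
  descriptions for spheres, opposites and distances rest on this.\<close>

lemma side_eq_imp_eq:
  assumes "lor v v = 1" "lor w w = 1" "side v = side w"
  shows "v = w"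
proof -
  have inj: "Some ` A = Some ` A' \<longleftrightarrow> A = A'" for A A' :: "'b set"
    by (simp add: inj_image_eq_iff)
  have None: "- (Some ` A) \<noteq> Some ` A'" for A A' :: "'b set"
    by blast
  from assms(1) show ?thesis
  proof (cases rule: unit_vector_cases)
    case v: (ball c r)
    from assms(2) show ?thesis
    proof (cases rule: unit_vector_cases)
      case (ball c' r')
      with v assms(3) show ?thesis by (auto simp: side_ball_vec inj ball_eq_ball_iff)
    next
      case (coball c' r')
      with v assms(3) show ?thesis by (metis side_ball_vec side_minus_ball_vec None)
    next
      case (plane a b)
      with v assms(3) show ?thesis by (simp add: side_ball_vec side_plane_vec inj ball_neq_halfspace)
    qed
  next
    case v: (coball c r)
    from assms(2) show ?thesis
    proof (cases rule: unit_vector_cases)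
      case (ball c' r')
      with v assms(3) show ?thesis by (metis side_ball_vec side_minus_ball_vec None)
    next
      case (coball c' r')
      with v assms(3) show ?thesis by (auto simp: side_minus_ball_vec inj cball_eq_cball_iff)
    next
      case (plane a b)
      with v assms(3) show ?thesis by (metis side_plane_vec side_minus_ball_vec None)
    qed
  next
    case v: (plane a b)
    from assms(2) show ?thesis
    proof (cases rule: unit_vector_cases)
      case (ball c' r')
      with v assms(3) show ?thesis by (metis side_ball_vec side_plane_vec inj ball_neq_halfspace)
    next
      case (coball c' r')
      with v assms(3) show ?thesis by (metis side_plane_vec side_minus_ball_vec None)
    next
      case (plane a' b')
      with v assms(3) halfspace_eq_imp[of a a' b b'] show ?thesis by (simp add: side_plane_vec inj)
    qed
  qed
qed

lemma side_nonempty: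
  assumes "lor v v = 1"
  shows "\<exists>x. Some x \<in> side v"
  using assms
proof (cases rule: unit_vector_cases)
  case (ball c r)
  then have "c \<in> ball c r" by simp
  with ball show ?thesis by (metis side_ball_vec imageI)
next
  case (coball c r)
  have "\<not> bounded (UNIV :: 'a set)" by (rule not_bounded_UNIV)
  then obtain x where "x \<notin> cball c r" by (metis UNIV_eq_I bounded_cball)
  with coball show ?thesis by (auto simp: side_minus_ball_vec)
next
  case (plane a b)
  then have "(b + 1) *\<^sub>R a \<in> {x. b < a \<bullet> x}" by (simp add: norm_eq_1)
  with plane show ?thesis by (metis side_plane_vec imageI)
qed

section \<open>Components of the complement of a sphere\<close>

text \<open>Vectors are triples; quantifiers over them are to stay whole and not be split into
  coordinates.\<close>

declare split_paired_All [simp del] split_paired_Ex [simp del]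

text \<open>Each of the two sets is clopen, so a connected set that meets one of them stays inside
  it.\<close>

lemma connected_components_of_eq_pair:
  assumes U: "openin X U" "connectedin X U" "U \<noteq> {}"
    and V: "openin X V" "connectedin X V" "V \<noteq> {}"
    and UV: "U \<inter> V = {}" "topspace X = U \<union> V"
  shows "connected_components_of X = {U, V}"
proof -
  have component: "W \<in> connected_components_of X"
    if W: "openin X W" "connectedin X W" "W \<noteq> {}" and closed: "closedin X W" for W
  proof -
    obtain x where x: "x \<in> W" using W(3) by blast
    have "connected_component_of_set X x = W"
    proof (rule connected_component_of_unique[OF x W(2)])
      fix C assume "x \<in> C \<and> connectedin X C"
      then show "C \<subseteq> W"
        using connectedin_clopen_cases[of X C W] closed W(1) x by (auto simp: disjnt_iff)
    qed
    moreover have "x \<in> topspace X" using x openin_subset[OF W(1)] by blast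
    ultimately show ?thesis using connected_component_in_connected_components_of by metis
  qed
  have "topspace X - V = U" "topspace X - U = V" using UV by auto
  then have "closedin X U" "closedin X V"
    using openin_closedin_eq U(1) V(1) by (metis closedin_diff closedin_topspace)+
  then have sub: "{U, V} \<subseteq> connected_components_of X" using component U V by blast
  have "C \<in> {U, V}" if C: "C \<in> connected_components_of X" for C
  proof (rule ccontr)
    assume "C \<notin> {U, V}"
    then have "disjnt C U" "disjnt C V"
      using pairwiseD[OF pairwise_disjoint_connected_components_of[of X] C] sub by auto
    moreover have "C \<subseteq> U \<union> V" "C \<noteq> {}"
      using connected_components_of_subset[OF C] nonempty_connected_components_of[OF C] UV by auto
    ultimately show False by (auto simp: disjnt_iff)
  qed
  with sub show ?thesis by blast
qed

abbreviation sphere_topology :: "'a::euclidean_space option topology" where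
  "sphere_topology \<equiv> Alexandroff_compactification euclidean"

lemma Compl_image_Some: "- (Some ` A) = insert None (Some ` (- A))"
proof (rule Set.set_eqI)
  show "p \<in> - (Some ` A) \<longleftrightarrow> p \<in> insert None (Some ` (- A))" for p by (cases p) auto
qed

lemma openin_side:
  assumes "lor v v = 1"
  shows "openin sphere_topology (side v)"
  using assms
proof (cases rule: unit_vector_cases)
  case (ball c r)
  then show ?thesis by (auto simp: side_ball_vec openin_Alexandroff_compactification)
next
  case (coball c r)
  have "compactin euclidean (cball c r) \<and> closedin euclidean (cball c r) \<and>
      insert None (Some ` (- cball c r)) = insert None (Some ` (topspace euclidean - cball c r))"
    by (simp add: Compl_eq_Diff_UNIV)
  with coball show ?thesis
    unfolding openin_Alexandroff_compactification
    by (metis side_minus_ball_vec Compl_image_Some)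
next
  case (plane a b)
  then show ?thesis
    using open_halfspace_gt[of b a] by (auto simp: side_plane_vec openin_Alexandroff_compactification)
qed

lemma connectedin_image_Some: "connected A \<Longrightarrow> connectedin sphere_topology (Some ` A)"
  by (rule connectedin_continuous_map_image[OF continuous_map_Some]) simp

text \<open>Neighbourhoods of infinity omit only a compact, hence bounded, set of finite
  points.\<close>

lemma None_in_closure_of_unbounded:
  assumes "\<not> bounded A"
  shows "None \<in> Abstract_Topology.closure_of sphere_topology (Some ` A)"
proof -
  have "\<exists>y\<in>Some ` A. y \<in> T" if T: "None \<in> T" "openin sphere_topology T" for T
  proof -
    obtain C where C: "compact C" "T = insert None (Some ` (- C))"
      using T unfolding openin_Alexandroff_compactification
      by (auto simp: Compl_eq_Diff_UNIV[symmetric])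
    then have "bounded C" using compact_imp_bounded by blast
    then have "\<not> A \<subseteq> C" using assms bounded_subset by blast
    with C show ?thesis by auto
  qed
  then show ?thesis by (simp add: in_closure_of)
qed

text \<open>For \<open>N = 1\<close> the exterior of a ball is connected only through \<^const>\<open>None\<close>, hence the
  decomposition into rays.\<close>

lemma connectedin_Compl_image_cball:
  fixes c :: "'a::euclidean_space"
  assumes "0 < r"
  shows "connectedin sphere_topology (- (Some ` cball c r))"
proof -
  define ray where "ray u = (\<lambda>t. c + t *\<^sub>R u) ` {r<..}" for u :: 'a
  have conn: "connectedin sphere_topology (insert None (Some ` ray u))" if "norm u = 1" for u
  \<comment> \<open>Infinity is in the closure of the unbounded ray, and adding closure points keeps
    a set connected.\<close>
  proof (rule connectedin_intermediate_closure_of)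
    have "connected (ray u)"
      unfolding ray_def by (intro connected_continuous_image continuous_intros) (simp add: convex_connected)
    then show *: "connectedin sphere_topology (Some ` ray u)" by (rule connectedin_image_Some)
    have "\<not> bounded (ray u)"
    proof
      assume "bounded (ray u)"
      then obtain M where M: "\<And>x. x \<in> ray u \<Longrightarrow> norm x \<le> M" by (auto simp: bounded_iff)
      define t where "t = \<bar>r\<bar> + \<bar>M\<bar> + norm c + 1"
      have "c + t *\<^sub>R u \<in> ray u" 
        unfolding ray_def t_def by (rule imageI) (use norm_ge_zero[of c] in \<open>simp, linarith\<close>)
      then have "norm (c + t *\<^sub>R u) \<le> M" by (rule M)
      moreover have "norm (t *\<^sub>R u) \<le> norm (c + t *\<^sub>R u) + norm c"
        using norm_triangle_ineq4[of "c + t *\<^sub>R u" c] by simp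
      ultimately show False using that by (simp add: t_def)
    qed
    then have "None \<in> Abstract_Topology.closure_of sphere_topology (Some ` ray u)"
      by (rule None_in_closure_of_unbounded)
    then show "insert None (Some ` ray u) \<subseteq> Abstract_Topology.closure_of sphere_topology (Some ` ray u)"
      using closure_of_subset[OF connectedin_subset_topspace[OF *]] by blast
  qed auto
  have "x \<in> ray ((x - c) /\<^sub>R norm (x - c)) \<and> norm ((x - c) /\<^sub>R norm (x - c)) = 1"
    if "x \<notin> cball c r" for x
  proof -
    have "r < norm (x - c)" using that by (simp add: dist_norm norm_minus_commute)
    moreover from this have "norm (x - c) \<noteq> 0" using assms by linarith
    then have "norm (x - c) * inverse (norm (x - c)) = 1" "inverse (norm (x - c)) * norm (x - c) = 1"
      using right_inverse left_inverse by blast+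
    ultimately show ?thesis by (auto simp: ray_def image_iff intro!: bexI[of _ "norm (x - c)"])
  qed
  moreover have "x \<notin> cball c r" if "x \<in> ray u" "norm u = 1" for x u
    using that assms by (auto simp: ray_def dist_norm)
  ultimately have "- cball c r = (\<Union>u\<in>{u. norm u = 1}. ray u)" by blast
  \<comment> \<open>Some direction must exist for the union of the extended rays to contain
    \<open>None\<close>, the point that they all share.\<close>
  moreover obtain u0 :: 'a where "norm u0 = 1"
    using norm_Basis nonempty_Basis by blast
  ultimately have "- (Some ` cball c r) = \<Union> ((\<lambda>u. insert None (Some ` ray u)) ` {u. norm u = 1})"
    unfolding Compl_image_Some by auto
  also have "connectedin sphere_topology \<dots>"
    by (rule connectedin_Union) (use conn in auto)
  finally show ?thesis .
qed

lemma connectedin_side: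
  assumes "lor v v = 1"
  shows "connectedin sphere_topology (side v)"
  using assms
proof (cases rule: unit_vector_cases)
  case (ball c r)
  then show ?thesis by (simp add: side_ball_vec connectedin_image_Some)
next
  case (coball c r)
  then show ?thesis by (simp add: side_minus_ball_vec connectedin_Compl_image_cball)
next
  case (plane a b)
  then show ?thesis
    by (simp add: side_plane_vec connectedin_image_Some convex_connected convex_halfspace_gt)
qed

lemma complement_components_zero_set:
  assumes "lor v v = 1"
  shows "complement_components (zero_set v) = {side v, side (- v)}"
proof -
  have v: "lor (- v) (- v) = 1" using assms by (simp add: lor_simps)
  have top: "topspace (subtopology sphere_topology (- zero_set v)) = side v \<union> side (- v)"
    by (simp add: Compl_zero_set) (metis UNIV_option_conv Int_UNIV_left)
  have side: "openin (subtopology sphere_topology (- zero_set v)) (side w) \<and>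
      connectedin (subtopology sphere_topology (- zero_set v)) (side w) \<and> side w \<noteq> {}"
    if "lor w w = 1" "side w \<subseteq> - zero_set v" for w
    using that openin_side[of w] connectedin_side[of w] side_nonempty[of w]
    by (auto simp: connectedin_subtopology openin_subtopology)
  show ?thesis unfolding complement_components_def
    by (rule connected_components_of_eq_pair)
      (use side[of v] side[of "- v"] assms v top side_Int_side_minus[of v] in
        \<open>auto simp: Compl_zero_set\<close>)
qed

lemma side_neq_side_minus:
  assumes "lor v v = 1"
  shows "side (- v) \<noteq> side v"
  using side_nonempty[OF assms] side_Int_side_minus[of v] by auto

lemma side_in_complement_components_iff:
  assumes "lor v v = 1" "lor w w = 1"
  shows "side v \<in> complement_components (zero_set w) \<longleftrightarrow> v = w \<or> v = - w"
  using assms side_eq_imp_eq[of v w] side_eq_imp_eq[of v "- w"]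
  by (auto simp: complement_components_zero_set lor_simps)

lemma is_open_ball_iff: "is_open_ball B \<longleftrightarrow> (\<exists>v. lor v v = 1 \<and> B = side v)"
proof
  assume "is_open_ball B"
  then obtain w where "lor w w = 1" "B \<in> complement_components (zero_set w)"
    by (auto simp: is_open_ball_def ext_spheres_eq_zero_sets)
  then have "B = side w \<or> B = side (- w)" "lor w w = 1" "lor (- w) (- w) = 1"
    by (auto simp: complement_components_zero_set lor_simps)
  then show "\<exists>v. lor v v = 1 \<and> B = side v" by blast
next
  assume "\<exists>v. lor v v = 1 \<and> B = side v"
  then obtain v where v: "lor v v = 1" "B = side v" by blast
  then have "zero_set v \<in> ext_spheres" "B \<in> complement_components (zero_set v)"
    using side_in_complement_components_iff[of v v] by (auto simp: ext_spheres_eq_zero_sets)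
  then show "is_open_ball B" unfolding is_open_ball_def by blast
qed

text \<open>Only \<open>v\<close> and \<open>- v\<close> have \<open>side v\<close> as a
  complementary component, and both have the same zero set.\<close>

lemma bounding_sphere_side:
  assumes "lor v v = 1"
  shows "bounding_sphere (side v) = zero_set v"
  unfolding bounding_sphere_def
proof (rule the_equality)
  show "zero_set v \<in> ext_spheres \<and> side v \<in> complement_components (zero_set v)"
    using assms by (auto simp: ext_spheres_eq_zero_sets side_in_complement_components_iff)
  fix S assume "S \<in> ext_spheres \<and> side v \<in> complement_components S"
  then obtain w where "lor w w = 1" "S = zero_set w" "side v \<in> complement_components (zero_set w)"
    by (auto simp: ext_spheres_eq_zero_sets)
  with assms show "S = zero_set v"
    by (auto simp: side_in_complement_components_iff zero_set_minus)
qed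

lemma opposite_ball_side:
  assumes "lor v v = 1"
  shows "opposite_ball (side v) = side (- v)"
  unfolding opposite_ball_def bounding_sphere_side[OF assms] complement_components_zero_set[OF assms]
  using side_neq_side_minus[OF assms] by (intro the_equality) auto

section \<open>The inversive distance as a Lorentz product\<close>

text \<open>The images of \<open>v\<close> and \<open>w\<close> under the isometry of
  \<open>g\<close> must be the vectors of the two Euclidean balls, by uniqueness. Their product is
  the explicit formula, which is why the value does not depend on \<open>g\<close>.\<close>

lemma mobius_inv_dist_side_imp:
  assumes v: "lor v v = 1" and w: "lor w w = 1" and "mobius_inv_dist (side v) (side w) d"
  shows "d = lor v w"
proof -
  obtain g c1 r1 c2 r2 where g: "g \<in> mobius_group" and r: "0 < r1" "0 < r2"
    and im: "g ` side v = Some ` ball c1 r1" "g ` side w = Some ` ball c2 r2"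
    and d: "d = (r1\<^sup>2 + r2\<^sup>2 - (norm (c1 - c2))\<^sup>2) / (2 * r1 * r2)"
    using assms(3) unfolding mobius_inv_dist_def by blast
  obtain T where T: "represents g T" using mobius_represented[OF g] by blast
  then have lor: "lor (T x) (T y) = lor x y" for x y unfolding represents_def by blast
  have "side (T v) = side (ball_vec c1 r1)" "side (T w) = side (ball_vec c2 r2)"
    using im represents_image_side[OF T] r by (simp_all add: side_ball_vec)
  then have "T v = ball_vec c1 r1" "T w = ball_vec c2 r2"
    using side_eq_imp_eq lor v w r lor_ball_vec_self by metis+
  then show ?thesis using lor[of v w] lor_ball_vec[OF r, of c1 c2] d by simp
qed

lemma ex_mobius_to_None:
  obtains f T where "f \<in> mobius_group" "represents f T" "f p = None"
proof (cases p)
  case None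
  then show thesis using that[OF id_in_mobius_group represents_id] by simp
next
  case (Some c)
  have "sphere_inversion c 1 p = None" using Some by (simp add: sphere_inversion_def)
  then show thesis
    using that[OF inversion_in_mobius_group[OF sphere_inversion_in_inversions]
        represents_sphere_inversion, of 1 c] by simp
qed

text \<open>Sending a point exterior to both balls to infinity makes both images Euclidean
  balls.\<close>

lemma ex_mobius_inv_dist:
  assumes v: "lor v v = 1" and w: "lor w w = 1" and p: "p \<in> side (- v)" "p \<in> side (- w)"
  shows "\<exists>d. mobius_inv_dist (side v) (side w) d"
proof -
  obtain f T where f: "f \<in> mobius_group" and T: "represents f T" and fp: "f p = None"
    by (rule ex_mobius_to_None)
  have "\<exists>c r. 0 < r \<and> f ` side x = Some ` ball c r" if x: "lor x x = 1" "p \<in> side (- x)" for x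
  proof -
    have "f p \<in> f ` side (- x)" using x(2) by blast
    then have "None \<in> side (T (- x))" unfolding represents_image_side[OF T] fp .
    moreover have "T (- x) = - T x" using T by (simp add: represents_def linear_neg)
    \<comment> \<open>Infinity is strictly outside the image. This excludes an exterior, where the
      product is \<open>1 / r\<close>, and a half-space, where it is 0.\<close>
    ultimately have None: "lor (T x) (pt None) < 0" by (simp add: side_def lor_simps del: pt_simps)
    have "lor (T x) (T x) = 1" using T x(1) unfolding represents_def by metis
    then show ?thesis
    proof (cases rule: unit_vector_cases)
      case (ball c r)
      then show ?thesis using represents_image_side[OF T, of x] side_ball_vec by metis
    next
      case (coball c r)
      with None show ?thesis by (simp add: lor_simps lor_ball_vec_None del: pt_simps)
    next
      case (plane a b)
      with None show ?thesis by (simp add: lor_plane_vec_None del: pt_simps)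
    qed
  qed
  note euclidean = this
  obtain c1 r1 where "0 < r1" "f ` side v = Some ` ball c1 r1"
    using euclidean[OF v p(1)] by (elim exE conjE)
  moreover obtain c2 r2 where "0 < r2" "f ` side w = Some ` ball c2 r2"
    using euclidean[OF w p(2)] by (elim exE conjE)
  moreover note f
  ultimately have "mobius_inv_dist (side v) (side w)
      ((r1\<^sup>2 + r2\<^sup>2 - (norm (c1 - c2))\<^sup>2) / (2 * r1 * r2))"
    unfolding mobius_inv_dist_def
    by (intro bexI[of _ f] exI[of _ c1] exI[of _ r1] exI[of _ c2] exI[of _ r2] conjI refl)
  then show ?thesis ..
qed

text \<open>Membership in the zero set is a polynomial equation of degree at most two in
  \<open>y\<close>, and a polynomial vanishing on an open set has zero coefficients.\<close>

lemma open_subset_zero_set_imp_zero: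
  assumes "open U" "x \<in> U" and U: "\<And>y. y \<in> U \<Longrightarrow> Some y \<in> zero_set v"
  shows "v = 0"
proof -
  obtain b a c where v: "v = (b, a, c)" by (cases v)
  obtain e where e: "e > 0" "ball x e \<subseteq> U" using assms(1,2) openE by blast
  have zero: "b \<bullet> y - a * ((norm y)\<^sup>2 / 2) - c = 0" if "y \<in> ball x e" for y
    using U[of y] e that by (auto simp: zero_set_def v lor_Pair)
  have x0: "b \<bullet> x - a * ((norm x)\<^sup>2 / 2) - c = 0" using zero[of x] e by simp
  have "a = 0 \<and> (b - a *\<^sub>R x) \<bullet> u = 0" if "u \<in> Basis" for u
  proof -
    define h where "h = e / 2"
    have h: "h > 0" "h < e" using e by (simp_all add: h_def)
    have n: "norm u = 1" "u \<bullet> u = 1" using that by (simp_all add: norm_Basis inner_same_Basis)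
    have expand: "h * ((b - a *\<^sub>R x) \<bullet> u) - a * h\<^sup>2 / 2 = 0" if "\<bar>h\<bar> < e" for h
    proof -
      have ball: "x + h *\<^sub>R u \<in> ball x e" using that n by (simp add: dist_norm)
      have "(norm (x + h *\<^sub>R u))\<^sup>2 = (norm x)\<^sup>2 + 2 * (h * (x \<bullet> u)) + h\<^sup>2"
        unfolding power2_norm_eq_inner
        by (simp add: inner_add_left inner_add_right n inner_commute[of u x] power2_eq_square
            distrib_left)
      moreover have "b \<bullet> (x + h *\<^sub>R u) = b \<bullet> x + h * (b \<bullet> u)" by (simp add: inner_add_right)
      ultimately have "h * (b \<bullet> u) - a * (h * (x \<bullet> u)) - a * h\<^sup>2 / 2 = 0"
        using zero[OF ball] x0 by (simp add: field_simps)
      then show ?thesis by (simp add: inner_diff_left right_diff_distrib mult.left_commute)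
    qed
    \<comment> \<open>Comparing the steps \<open>h\<close> and \<open>- h\<close> separates the even
      part, which yields \<open>a = 0\<close>, from the odd part.\<close>
    have 1: "h * ((b - a *\<^sub>R x) \<bullet> u) - a * h\<^sup>2 / 2 = 0" using expand[of h] h by simp
    have 2: "- h * ((b - a *\<^sub>R x) \<bullet> u) - a * h\<^sup>2 / 2 = 0" using expand[of "- h"] h by simp
    have "a * h\<^sup>2 = 0" "h * ((b - a *\<^sub>R x) \<bullet> u) = 0" using 1 2 by linarith+
    with h show ?thesis by simp
  qed
  note basis = this
  have "a = 0" using basis[OF SOME_Basis] by blast
  have "b \<bullet> u = 0" if "u \<in> Basis" for u
    using conjunct2[OF basis[OF that]] unfolding \<open>a = 0\<close> scale_zero_left diff_zero .
  then have "b = 0" by (intro euclidean_eqI[of b]) simp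
  with x0 \<open>a = 0\<close> show ?thesis by (simp add: v zero_prod_def)
qed

text \<open>If neither \<open>v\<close> nor \<open>- v\<close> could be paired with
  \<open>w\<close>, no point of \<open>side (- w)\<close> would lie on either side of
  \<open>v\<close>. The zero set of \<open>v\<close> would then contain a nonempty open set, which
  is impossible for a unit vector. So the sign rule always yields a value.\<close>

lemma inv_dist_side:
  assumes v: "lor v v = 1" and w: "lor w w = 1"
  shows "inv_dist (side v) (side w) = lor v w"
proof (cases "\<exists>d. mobius_inv_dist (side v) (side w) d")
  case True
  then obtain d where "mobius_inv_dist (side v) (side w) d" by blast
  then have "(THE d. mobius_inv_dist (side v) (side w) d) = lor v w"
    using mobius_inv_dist_side_imp[OF v w] by (metis the_equality)
  with True show ?thesis by (simp add: inv_dist_def)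
next
  case False
  have v': "lor (- v) (- v) = 1" and w': "lor (- w) (- w) = 1" using v w by (simp_all add: lor_simps)
  have "\<exists>d. mobius_inv_dist (side (- v)) (side w) d"
  proof (rule ccontr)
    assume no: "\<nexists>d. mobius_inv_dist (side (- v)) (side w) d"
    have "p \<in> zero_set v" if "p \<in> side (- w)" for p
    proof -
      have "p \<notin> side (- v)" "p \<notin> side v"
        using ex_mobius_inv_dist[OF v w _ that] ex_mobius_inv_dist[OF v' w _ that] False no by auto
      then show ?thesis using Compl_zero_set[of v] by blast
    qed
    moreover have "open {y. Some y \<in> side (- w)}"
    proof -
      have "openin euclidean {y \<in> topspace euclidean. Some y \<in> side (- w)}"
        using openin_continuous_map_preimage[OF continuous_map_Some openin_side[OF w']] .
      then show ?thesis by simp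
    qed
    moreover obtain x where "x \<in> {y. Some y \<in> side (- w)}" using side_nonempty[OF w'] by blast
    ultimately have "v = 0" using open_subset_zero_set_imp_zero[of "{y. Some y \<in> side (- w)}" x v] by blast
    with v show False by (simp add: lor_simps)
  qed
  then obtain d where d: "mobius_inv_dist (side (- v)) (side w) d" by blast
  then have "(THE d. mobius_inv_dist (side (- v)) (side w) d) = - lor v w"
    using mobius_inv_dist_side_imp[OF v' w] by (metis the_equality lor_minus_left)
  with False show ?thesis by (simp add: inv_dist_def opposite_ball_side[OF v])
qed

section \<open>Families with equal Gram matrices\<close>

definition lor_perp :: "('a::euclidean_space \<times> real \<times> real) set \<Rightarrow> ('a \<times> real \<times> real) set" where
  "lor_perp V = {y. \<forall>x\<in>V. lor x y = 0}"

lemma lor_pythagoras: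
  assumes "lor x y = 0"
  shows "lor (x + t *\<^sub>R y) (x + t *\<^sub>R y) = lor x x + t\<^sup>2 * lor y y"
  using assms lor_commute[of y x] by (simp add: lor_simps power2_eq_square)

lemma subspace_lor_perp: "subspace (lor_perp V)"
  by (auto simp: subspace_def lor_perp_def lor_simps)

lemma lor_perp_span: "lor_perp (span V) = lor_perp V"
proof -
  have "lor x y = 0" if "y \<in> lor_perp V" "x \<in> span V" for x y
    using that(2)
  proof (induction rule: span_induct_alt)
    case base
    show ?case by (simp add: lor_simps)
  next
    case (step c x z)
    with that(1) show ?case by (simp add: lor_perp_def lor_simps)
  qed
  then show ?thesis using span_superset[of V] by (auto simp: lor_perp_def)
qed

lemma lor_perp_eq_image: "lor_perp V = lor_flip ` {y. \<forall>x\<in>V. orthogonal x y}"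
proof
  show "lor_perp V \<subseteq> lor_flip ` {y. \<forall>x\<in>V. orthogonal x y}"
  proof
    fix y assume "y \<in> lor_perp V"
    then have "lor_flip y \<in> {y. \<forall>x\<in>V. orthogonal x y}"
      by (simp add: lor_perp_def lor_eq_inner orthogonal_def)
    then show "y \<in> lor_flip ` {y. \<forall>x\<in>V. orthogonal x y}"
      by (rule image_eqI[rotated]) simp
  qed
qed (auto simp: lor_perp_def lor_eq_inner orthogonal_def)

text \<open>The complement for \<open>lor\<close> is the image of the Euclidean one under the
  injective map \<open>lor_flip\<close>.\<close>

lemma dim_lor_perp:
  fixes V :: "('a::euclidean_space \<times> real \<times> real) set"
  assumes "subspace V"
  shows "dim (lor_perp V) + dim V = DIM('a \<times> real \<times> real)"
proof -
  have "dim (lor_flip ` {y. \<forall>x\<in>V. orthogonal x y}) = dim {y. \<forall>x\<in>V. orthogonal x y}"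
    by (rule dim_image_eq[OF linear_lor_flip]) (use inj_lor_flip inj_on_subset in blast)
  then show ?thesis
    using dim_subspace_orthogonal_to_vectors[OF assms subspace_UNIV]
    by (simp add: lor_perp_eq_image)
qed

text \<open>The dimensions of \<open>V\<close> and its complement add up to the full dimension, and
  they meet only in 0.\<close>

lemma lor_decomposition:
  fixes V :: "('a::euclidean_space \<times> real \<times> real) set"
  assumes V: "subspace V" and nondeg: "V \<inter> lor_perp V = {0}"
  obtains p q where "p \<in> V" "q \<in> lor_perp V" "w = p + q"
proof -
  define S where "S = {x + y |x y. x \<in> V \<and> y \<in> lor_perp V}"
  have "dim S + dim (V \<inter> lor_perp V) = dim V + dim (lor_perp V)"
    unfolding S_def by (rule dim_sums_Int[OF V subspace_lor_perp])
  then have "dim S = DIM('a \<times> real \<times> real)" using dim_lor_perp[OF V] nondeg by simp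
  moreover have "subspace S" unfolding S_def by (rule subspace_sums[OF V subspace_lor_perp])
  ultimately have "S = UNIV" by (metis dim_eq_full span_eq_iff)
  then have "w \<in> S" by simp
  with that show thesis unfolding S_def by blast
qed

text \<open>Split the timelike vector \<open>(0, 1, 1)\<close> along \<open>V\<close> and its
  complement: the norms of the parts add up to a negative number, so one of them is
  negative.\<close>

lemma timelike_in_or_perp:
  fixes V :: "('a::euclidean_space \<times> real \<times> real) set"
  assumes V: "subspace V" and nondeg: "V \<inter> lor_perp V = {0}"
  obtains (inside) e where "e \<in> V" "lor e e < 0"
    | (perp) e where "e \<in> lor_perp V" "lor e e < 0"
proof -
  obtain p q where pq: "p \<in> V" "q \<in> lor_perp V" "(0, 1, 1) = p + q"
    by (rule lor_decomposition[OF assms])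
  have "lor p q = 0" using pq by (simp add: lor_perp_def)
  then have "lor (p + q) (p + q) = lor p p + lor q q"
    by (simp add: lor_simps lor_commute[of q p])
  moreover have "lor (p + q) (p + q) < 0" unfolding pq(3)[symmetric] by (simp add: lor_Pair)
  ultimately have "lor p p < 0 \<or> lor q q < 0" by linarith
  then show thesis using inside perp pq by blast
qed

text \<open>Otherwise \<open>W\<close> also contains a spacelike vector, and \<open>lor\<close> changes sign on the plane it
  spans with \<open>e\<close>.\<close>

lemma timelike_subspace_no_null:
  assumes W: "subspace W" and e: "e \<in> W" "lor e e < 0"
    and no_null: "\<And>x. x \<in> W \<Longrightarrow> lor x x = 0 \<Longrightarrow> x = 0" and q: "q \<in> W"
  obtains k where "q = k *\<^sub>R e"
proof -
  define k where "k = lor e q / lor e e"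
  define x where "x = q - k *\<^sub>R e"
  have xW: "x \<in> W" unfolding x_def by (intro subspace_diff subspace_scale W q e)
  have ex: "lor e x = 0" using e by (simp add: x_def k_def lor_simps)
  have "x = 0"
  proof (rule ccontr)
    assume "x \<noteq> 0"
    then have xx: "0 < lor x x" using orthogonal_timelike_imp_spacelike[OF e(2) ex] by blast
    define t where "t = sqrt (- lor e e / lor x x)"
    have "0 \<le> - lor e e / lor x x" using e(2) xx by (intro divide_nonneg_pos) simp_all
    then have "t\<^sup>2 = - lor e e / lor x x" unfolding t_def by (rule real_sqrt_pow2)
    then have "t\<^sup>2 * lor x x = - lor e e" using xx by simp
    then have "lor (e + t *\<^sub>R x) (e + t *\<^sub>R x) = 0"
      by (simp add: lor_simps ex lor_commute[of x e] power2_eq_square)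
    moreover have "e + t *\<^sub>R x \<in> W" by (intro subspace_add subspace_scale W e xW)
    ultimately have "e + t *\<^sub>R x = 0" using no_null by blast
    then have "lor e (e + t *\<^sub>R x) = 0" by (simp add: lor_simps)
    with e ex show False by (simp add: lor_simps)
  qed
  then have "q = k *\<^sub>R e" by (simp add: x_def)
  then show thesis by (rule that)
qed

text \<open>The product \<open>lor e e'\<close> cannot vanish, since \<open>e'\<close> would then be
  spacelike. If it is positive, \<open>e'\<close> and all \<open>u' i\<close> are negated, which
  changes neither norms nor products within the family.\<close>

lemma mobius_isometry_of_equal_gram:
  fixes u u' :: "'i \<Rightarrow> 'a::euclidean_space \<times> real \<times> real"
  assumes "finite I"
    and e: "lor e e < 0" "lor e' e' = lor e e"
    and eu: "\<And>i. i \<in> I \<Longrightarrow> lor e' (u' i) = lor e (u i)"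
    and uu: "\<And>i j. i \<in> I \<Longrightarrow> j \<in> I \<Longrightarrow> lor (u' i) (u' j) = lor (u i) (u j)"
  obtains T and s :: real where "T \<in> mobius_isometries" "s = 1 \<or> s = -1"
    "\<And>i. i \<in> I \<Longrightarrow> T (u i) = s *\<^sub>R u' i"
proof -
  have "e' \<noteq> 0" using e by (auto simp: lor_simps)
  then have "lor e e' \<noteq> 0" using orthogonal_timelike_imp_spacelike[OF e(1), of e'] e by auto
  then consider "lor e e' < 0" | "lor e e' > 0" by linarith
  then show thesis
  proof cases
    case 1
    then show thesis
      using isometry_extension[of I e e' u' u] assms that[of _ 1] by auto
  next
    case 2
    have "\<exists>T\<in>mobius_isometries. T e = - e' \<and> (\<forall>i\<in>I. T (u i) = - u' i)"
      by (rule isometry_extension) (use 2 assms in \<open>simp_all add: lor_simps\<close>)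
    then show thesis using that[of _ "-1"] by auto
  qed
qed

text \<open>The isometry is built from finitely many \<open>v \<alpha>\<close> spanning \<open>V\<close>.  Its values at the others
  are forced: the error \<open>\<delta>\<close> is a null vector orthogonal to the \<open>v' i\<close> of the spanning subfamily.
  If \<open>e\<close> is orthogonal to \<open>V\<close>, the partner \<open>n\<close> of \<open>e\<close> is any nonzero vector orthogonal to the
  \<open>v' i\<close>; it is timelike since otherwise the induced bijection \<open>M\<close> would make \<open>lor\<close>
  positive semidefinite.\<close>

lemma mobius_isometry_of_family:
  fixes v v' :: "'i \<Rightarrow> 'a::euclidean_space \<times> real \<times> real"
  assumes gram: "\<And>\<alpha> \<beta>. \<alpha> \<in> A \<Longrightarrow> \<beta> \<in> A \<Longrightarrow> lor (v' \<alpha>) (v' \<beta>) = lor (v \<alpha>) (v \<beta>)"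
    and no_null: "\<And>x. x \<in> lor_perp (v ` A) \<Longrightarrow> lor x x = 0 \<Longrightarrow> x = 0"
  obtains T and s :: real where "T \<in> mobius_isometries" "s = 1 \<or> s = -1"
    "\<And>\<alpha>. \<alpha> \<in> A \<Longrightarrow> T (v \<alpha>) = s *\<^sub>R v' \<alpha>"
proof -
  note result = that
  define V where "V = span (v ` A)"
  have V: "subspace V" by (simp add: V_def)
  have perpV: "lor_perp V = lor_perp (v ` A)" by (simp add: V_def lor_perp_span)
  \<comment> \<open>A vector in both subspaces is orthogonal to itself, hence null.\<close>
  have nondeg: "V \<inter> lor_perp V = {0}"
  proof -
    have "x = 0" if "x \<in> V" "x \<in> lor_perp V" for x
      using that no_null[of x] perpV by (auto simp: lor_perp_def)
    moreover have "0 \<in> V" "0 \<in> lor_perp V"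
      using subspace_0[OF V] subspace_0[OF subspace_lor_perp] by auto
    ultimately show ?thesis by blast
  qed
  \<comment> \<open>The basis is indexed by a finite \<open>I\<close>, so that a linear combination
    of the \<open>v i\<close> can be compared with the same combination of the
    \<open>v' i\<close>.\<close>
  obtain B where B: "B \<subseteq> v ` A" "independent B" "v ` A \<subseteq> span B" "card B = dim (v ` A)"
    by (rule basis_exists)
  have "\<exists>I. I \<subseteq> A \<and> inj_on v I \<and> B = v ` I"
    using B(1) by (rule subset_image_inj[THEN iffD1])
  then obtain I where I: "I \<subseteq> A" "inj_on v I" "v ` I = B" by auto
  have finI: "finite I"
    using finite_imageD[OF _ I(2)] finiteI_independent[OF B(2)] I(3) by simp
  have VB: "V = span B" unfolding V_def
    by (rule span_eq[THEN iffD2]) (use B span_superset in \<open>auto intro: span_base\<close>)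
  have comb: "\<exists>k. x = (\<Sum>i\<in>I. k i *\<^sub>R v i)" if xV: "x \<in> V" for x
  proof -
    obtain k where "x = (\<Sum>b\<in>B. k b *\<^sub>R b)"
      using xV VB span_finite[OF finiteI_independent[OF B(2)]] by auto
    then have "x = (\<Sum>i\<in>I. k (v i) *\<^sub>R v i)"
      using sum.reindex[OF I(2), of "\<lambda>b. k b *\<^sub>R b"] I(3) by simp
    then show ?thesis by (rule exI[of _ "\<lambda>i. k (v i)"])
  qed
  have gramI: "lor (v' i) (v' j) = lor (v i) (v j)" if "i \<in> I" "j \<in> I" for i j
    using gram I that by blast
  have lor_sum: "lor y (\<Sum>i\<in>I. k i *\<^sub>R w i) = (\<Sum>i\<in>I. k i * lor y (w i))" for y k and w :: "'i \<Rightarrow> _"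
    by (simp add: linear_sum[OF linear_lor] lor_simps)
  have lor_comb: "lor (v' \<alpha>) (\<Sum>i\<in>I. k i *\<^sub>R v' i) = lor (v \<alpha>) (\<Sum>i\<in>I. k i *\<^sub>R v i)"
    if "\<alpha> \<in> A" for \<alpha> k
    unfolding lor_sum using gram I that by (intro sum.cong) auto
  have lor_comb2: "lor (\<Sum>i\<in>I. k i *\<^sub>R v' i) (\<Sum>i\<in>I. l i *\<^sub>R v' i) =
      lor (\<Sum>i\<in>I. k i *\<^sub>R v i) (\<Sum>i\<in>I. l i *\<^sub>R v i)" for k l
    unfolding lor_sum lor_commute[of "\<Sum>i\<in>I. k i *\<^sub>R _ i"] lor_sum
    using gramI by (intro sum.cong) auto
  \<comment> \<open>Both cases below end here; each has only to supply a partner \<open>e'\<close>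
    of \<open>e\<close> and to exclude a nonzero null vector orthogonal to the
    \<open>v' i\<close>.\<close>
  have extend: thesis
    if e: "lor e e < 0" "lor e' e' = lor e e" "\<And>i. i \<in> I \<Longrightarrow> lor e' (v' i) = lor e (v i)"
      and null: "\<And>\<delta>. lor \<delta> \<delta> = 0 \<Longrightarrow> \<forall>i\<in>I. lor (v' i) \<delta> = 0 \<Longrightarrow> \<delta> = 0"
    for e e'
  proof -
    obtain T s where T: "T \<in> mobius_isometries" and s: "s = 1 \<or> s = -1"
      and Tv: "\<And>i. i \<in> I \<Longrightarrow> T (v i) = s *\<^sub>R v' i"
      by (rule mobius_isometry_of_equal_gram[where u = v and u' = v', OF finI e gramI]) auto
    have "T (v \<alpha>) = s *\<^sub>R v' \<alpha>" if \<alpha>: "\<alpha> \<in> A" for \<alpha>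
    proof -
      have "v \<alpha> \<in> V" using \<alpha> by (simp add: V_def span_base)
      then obtain k where k: "v \<alpha> = (\<Sum>i\<in>I. k i *\<^sub>R v i)" using comb by blast
      \<comment> \<open>By linearity \<open>s *\<^sub>R y\<close> is the value of \<open>T\<close>
        at \<open>v \<alpha>\<close>; it remains to see that the error
        \<open>v' \<alpha> - y\<close> is such a null vector.\<close>
      define y where "y = (\<Sum>i\<in>I. k i *\<^sub>R v' i)"
      have "lor (v' \<alpha>) y = lor (v \<alpha>) (v \<alpha>)" using lor_comb[OF \<alpha>, of k] k by (simp add: y_def)
      moreover have "lor y y = lor (v \<alpha>) (v \<alpha>)" using lor_comb2[of k k] k by (simp add: y_def)
      moreover have "lor y (v' \<alpha>) = lor (v' \<alpha>) y" by (rule lor_commute)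
      ultimately have "lor (v' \<alpha> - y) (v' \<alpha> - y) = 0"
        using gram[OF \<alpha> \<alpha>] unfolding lor_diff_left lor_diff_right by linarith
      moreover have "lor (v' i) (v' \<alpha> - y) = 0" if "i \<in> I" for i
      proof -
        have "lor (v' i) y = lor (v i) (v \<alpha>)" using lor_comb[of i k] that I k by (auto simp: y_def)
        then show ?thesis using gram[of i \<alpha>] that I \<alpha> by (auto simp: lor_simps)
      qed
      ultimately have "v' \<alpha> = y" using null[of "v' \<alpha> - y"] by simp
      moreover have "T (v \<alpha>) = (\<Sum>i\<in>I. k i *\<^sub>R T (v i))"
        using linear_mobius_isometry[OF T] by (subst k) (simp add: linear_sum linear_scale)
      moreover have "\<dots> = s *\<^sub>R y"
        unfolding y_def scaleR_sum_right by (rule sum.cong) (simp_all add: Tv mult.commute)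
      ultimately show ?thesis by simp
    qed
    with result T s show thesis by blast
  qed
  from V nondeg show thesis
  proof (cases rule: timelike_in_or_perp)
    case (inside e)
    then obtain l where l: "e = (\<Sum>i\<in>I. l i *\<^sub>R v i)" using comb by blast
    \<comment> \<open>The partner of \<open>e\<close> has the same coefficients, so it is again
      timelike, and a null vector orthogonal to the \<open>v' i\<close> is orthogonal to it and must
      be 0.\<close>
    define e' where "e' = (\<Sum>i\<in>I. l i *\<^sub>R v' i)"
    have ee: "lor e' e' = lor e e" using lor_comb2[of l l] by (simp add: e'_def l)
    show thesis
    proof (rule extend[of e e'])
      show "lor e' (v' i) = lor e (v i)" if "i \<in> I" for i
        using lor_comb[of i l] that I l by (auto simp: e'_def lor_commute[of _ "v' i"] lor_commute[of _ "v i"])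
      fix \<delta>
      assume \<delta>: "lor \<delta> \<delta> = 0" "\<forall>i\<in>I. lor (v' i) \<delta> = 0"
      have "lor \<delta> e' = 0" unfolding e'_def lor_sum using \<delta>(2) by (simp add: lor_commute)
      then show "\<delta> = 0"
        using orthogonal_timelike_imp_spacelike[of e' \<delta>] ee inside \<delta>(1)
        by (auto simp: lor_commute)
    qed (use ee inside in auto)
  next
    case (perp e)
    \<comment> \<open>A complement that contains a timelike vector but no nonzero null vector is the
      line through \<open>e\<close>.\<close>
    have span_e: "\<exists>k t. w = (\<Sum>i\<in>I. k i *\<^sub>R v i) + t *\<^sub>R e" for w
    proof -
      obtain p q where pq: "p \<in> V" "q \<in> lor_perp V" "w = p + q"
        by (rule lor_decomposition[OF V nondeg])
      moreover obtain t where "q = t *\<^sub>R e"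
        using timelike_subspace_no_null[OF subspace_lor_perp perp no_null[folded perpV] pq(2)] by blast
      ultimately show ?thesis using comb by blast
    qed
    have ve: "lor e (v i) = 0" if "i \<in> I" for i
    proof -
      have "v i \<in> V" using that I by (auto simp: V_def intro: span_base)
      then show ?thesis using perp(1) by (simp add: lor_perp_def lor_commute[of e])
    qed
    have posV: "0 < lor x x" if "x \<in> V" "x \<noteq> 0" for x
      using orthogonal_timelike_imp_spacelike[OF perp(2), of x] that perp(1)
      by (auto simp: lor_perp_def lor_commute[of e x])
    define D where "D = DIM('a \<times> real \<times> real)"
    have "e \<notin> V" using perp by (auto simp: lor_perp_def)
    then have "V \<noteq> UNIV" by blast
    then have "dim V < D"
      unfolding D_def using dim_eq_full[of V] dim_subset_UNIV[of V] span_eq_iff V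
      by (metis le_neq_implies_less)
    moreover have "dim V = card I" using B(4) card_image[OF I(2)] I(3) by (simp add: V_def)
    moreover have "dim (v' ` I) \<le> card I"
      using dim_le_card'[of "v' ` I"] card_image_le[OF finI, of v'] finI by simp
    ultimately have "dim (v' ` I) < DIM('a \<times> real \<times> real)" by (simp add: D_def)
    \<comment> \<open>There are fewer \<open>v' i\<close> than dimensions, so a nonzero Euclidean
      normal exists; flipping it gives a vector orthogonal for \<open>lor\<close>.\<close>
    then obtain z where z: "z \<noteq> 0" "\<And>y. y \<in> span (v' ` I) \<Longrightarrow> orthogonal z y"
      by (rule orthogonal_to_subspace_exists) blast
    define n where "n = lor_flip z"
    have n0: "n \<noteq> 0" using z(1) by (metis n_def lor_flip_flip linear_0 linear_lor_flip)
    have vn: "lor (v' i) n = 0" if "i \<in> I" for i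
      using z(2)[of "v' i"] that
      by (simp add: n_def lor_eq_inner orthogonal_def inner_commute span_base)
    \<comment> \<open>\<open>M\<close> sends the basis \<open>v i\<close>, \<open>e\<close> to
      \<open>v' i\<close>, \<open>n\<close>. It need not be an isometry yet, as the norm of
      \<open>n\<close> is still unknown.\<close>
    have "\<exists>M. linear M \<and> (\<forall>k t. M ((\<Sum>i\<in>I. k i *\<^sub>R v i) + t *\<^sub>R e) = (\<Sum>i\<in>I. k i *\<^sub>R v' i) + t *\<^sub>R n)"
    proof -
      have eB: "independent (insert e B)"
        using B(2) \<open>e \<notin> V\<close> VB by (simp add: independent_insert)
      have eI: "e \<notin> B" using \<open>e \<notin> V\<close> VB span_base by blast
      obtain M where M: "linear M" "\<And>x. x \<in> insert e B \<Longrightarrow> M x = (if x = e then n else v' (inv_into I v x))"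
        using linear_independent_extend[OF eB, of "\<lambda>x. if x = e then n else v' (inv_into I v x)"]
        by blast
      have "M (v i) = v' i" if "i \<in> I" for i
        using M(2)[of "v i"] that I eI inv_into_f_f[OF I(2) that] by auto
      moreover have "M e = n" using M(2)[of e] by simp
      ultimately have "M ((\<Sum>i\<in>I. k i *\<^sub>R v i) + t *\<^sub>R e) = (\<Sum>i\<in>I. k i *\<^sub>R v' i) + t *\<^sub>R n" for k t
        using M(1) by (simp add: linear_add linear_sum linear_scale)
      with M(1) show ?thesis by blast
    qed
    then obtain M where M: "linear M"
      "\<And>k t. M ((\<Sum>i\<in>I. k i *\<^sub>R v i) + t *\<^sub>R e) = (\<Sum>i\<in>I. k i *\<^sub>R v' i) + t *\<^sub>R n" by blast
    have perp_n: "lor (\<Sum>i\<in>I. k i *\<^sub>R v' i) n = 0" for k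
      unfolding lor_commute[of _ n] lor_sum using vn by (simp add: lor_commute)
    have lorM: "lor (M ((\<Sum>i\<in>I. k i *\<^sub>R v i) + t *\<^sub>R e)) (M ((\<Sum>i\<in>I. k i *\<^sub>R v i) + t *\<^sub>R e)) =
        lor (\<Sum>i\<in>I. k i *\<^sub>R v i) (\<Sum>i\<in>I. k i *\<^sub>R v i) + t\<^sup>2 * lor n n" for k t
      unfolding M(2) lor_pythagoras[OF perp_n] lor_comb2 ..
    have combV: "(\<Sum>i\<in>I. k i *\<^sub>R v i) \<in> V" for k
      unfolding V_def using I by (intro span_sum span_scale span_base) auto
    \<comment> \<open>In a relation \<open>p + t *\<^sub>R n = 0\<close> the vector \<open>p\<close>
      is orthogonal to \<open>n\<close>, hence null. Its norm is that of the same combination in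
      \<open>V\<close>, where \<open>lor\<close> is positive definite, so that combination is
      0.\<close>
    have "inj M"
    proof (subst linear_injective_0[OF M(1)], intro allI impI)
      fix w assume w: "M w = 0"
      obtain k t where kt: "w = (\<Sum>i\<in>I. k i *\<^sub>R v i) + t *\<^sub>R e" using span_e by blast
      define p where "p = (\<Sum>i\<in>I. k i *\<^sub>R v' i)"
      have Mw: "p + t *\<^sub>R n = 0" using M(2)[of k t] w kt by (simp add: p_def)
      have "lor p p = lor p (p + t *\<^sub>R n)" using perp_n[of k] by (simp add: p_def lor_simps)
      then have "lor p p = 0" unfolding Mw lor_zero_right .
      then have "lor (\<Sum>i\<in>I. k i *\<^sub>R v i) (\<Sum>i\<in>I. k i *\<^sub>R v i) = 0"
        unfolding p_def lor_comb2 .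
      then have k0: "(\<Sum>i\<in>I. k i *\<^sub>R v i) = 0" using posV[OF combV[of k]] by auto
      have "M 0 = p" using M(2)[of k 0] k0 by (simp add: p_def)
      then have "p = 0" using linear_0[OF M(1)] by simp
      with Mw n0 have "t = 0" by simp
      with kt k0 show "w = 0" by simp
    qed
    then have "surj M" by (rule linear_inj_imp_surj[OF M(1)])
    \<comment> \<open>The timelike \<open>e\<close> is a value of \<open>M\<close>, and its norm is
      a nonnegative term plus \<open>t\<^sup>2 * lor n n\<close>; so \<open>n\<close> is
      timelike.\<close>
    then obtain w where w: "M w = e" by (metis surjD)
    obtain k t where kt: "w = (\<Sum>i\<in>I. k i *\<^sub>R v i) + t *\<^sub>R e" using span_e by blast
    have "lor (\<Sum>i\<in>I. k i *\<^sub>R v i) (\<Sum>i\<in>I. k i *\<^sub>R v i) \<ge> 0"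
      using posV[OF combV[of k]] by (cases "(\<Sum>i\<in>I. k i *\<^sub>R v i) = 0") (auto simp: lor_simps)
    then have "t\<^sup>2 * lor n n < 0" using lorM[of k t] w kt perp(2) by simp
    then have nn: "lor n n < 0" by (meson mult_nonneg_nonneg not_less zero_le_power2)
    \<comment> \<open>The multiple \<open>r *\<^sub>R n\<close> has the same norm as
      \<open>e\<close>.\<close>
    define r where "r = sqrt (lor e e / lor n n)"
    have r: "r * (r * lor n n) = lor e e"
    proof -
      have "r\<^sup>2 = lor e e / lor n n" using nn perp(2) by (simp add: r_def divide_nonpos_nonpos)
      then show ?thesis using nn by (simp add: power2_eq_square mult.assoc[symmetric])
    qed
    show thesis
    proof (rule extend[of e "r *\<^sub>R n"])
      show "lor (r *\<^sub>R n) (r *\<^sub>R n) = lor e e" using r by (simp add: lor_simps)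
      show "lor (r *\<^sub>R n) (v' i) = lor e (v i)" if "i \<in> I" for i
        using vn[OF that] ve[OF that] by (simp add: lor_simps lor_commute)
      fix \<delta>
      assume \<delta>: "lor \<delta> \<delta> = 0" "\<forall>i\<in>I. lor (v' i) \<delta> = 0"
      obtain w where w: "M w = \<delta>" using \<open>surj M\<close> by (metis surjD)
      obtain k t where kt: "w = (\<Sum>i\<in>I. k i *\<^sub>R v i) + t *\<^sub>R e" using span_e by blast
      have dl: "\<delta> = (\<Sum>i\<in>I. k i *\<^sub>R v' i) + t *\<^sub>R n" using M(2)[of k t] w kt by simp
      \<comment> \<open>Orthogonality to the \<open>v' i\<close> leaves only the component along
        \<open>n\<close>, which must vanish because \<delta> is null; definiteness on
        \<open>V\<close> removes the rest.\<close>
      have "lor \<delta> \<delta> = lor \<delta> (t *\<^sub>R n)"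
      proof -
        have "lor \<delta> (\<Sum>i\<in>I. k i *\<^sub>R v' i) = 0"
          unfolding lor_sum using \<delta>(2) by (simp add: lor_commute)
        then show ?thesis by (subst (2) dl) (simp add: lor_simps)
      qed
      also have "\<dots> = t\<^sup>2 * lor n n"
        using perp_n[of k] by (subst dl) (simp add: lor_simps power2_eq_square)
      finally have t: "t = 0" using \<delta>(1) nn by simp
      then have "lor (\<Sum>i\<in>I. k i *\<^sub>R v i) (\<Sum>i\<in>I. k i *\<^sub>R v i) = 0"
        using lorM[of k t] w kt \<delta>(1) by simp
      then have "w = 0" using posV[OF combV[of k]] kt t by auto
      then show "\<delta> = 0" using w linear_0[OF M(1)] by simp
    qed (use perp in auto)
  qed
qed

section \<open>Translating balls and spheres into Gram matrices\<close>

theorem theorem1: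
  fixes \<A> :: "'i set"
    and B B' :: "'i \<Rightarrow> (real ^ 'n) option set"
  assumes "\<And>\<alpha>. \<alpha> \<in> \<A> \<Longrightarrow> is_open_ball (B \<alpha>)"
    and "\<And>\<alpha>. \<alpha> \<in> \<A> \<Longrightarrow> is_open_ball (B' \<alpha>)"
    and "(\<Inter>\<alpha>\<in>\<A>. bounding_sphere (B \<alpha>)) = {}"
  shows "(\<exists>f\<in>mobius_group. (\<forall>\<alpha>\<in>\<A>. f ` B \<alpha> = B' \<alpha>) \<or>
                         (\<forall>\<alpha>\<in>\<A>. f ` opposite_ball (B \<alpha>) = B' \<alpha>)) \<longleftrightarrow>
         (\<forall>\<alpha>\<in>\<A>. \<forall>\<beta>\<in>\<A>. inv_dist (B \<alpha>) (B \<beta>) = inv_dist (B' \<alpha>) (B' \<beta>))"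
proof -
  obtain v where v: "\<And>\<alpha>. \<alpha> \<in> \<A> \<Longrightarrow> lor (v \<alpha>) (v \<alpha>) = 1" "\<And>\<alpha>. \<alpha> \<in> \<A> \<Longrightarrow> B \<alpha> = side (v \<alpha>)"
    using assms(1) unfolding is_open_ball_iff by metis
  obtain v' where v': "\<And>\<alpha>. \<alpha> \<in> \<A> \<Longrightarrow> lor (v' \<alpha>) (v' \<alpha>) = 1" "\<And>\<alpha>. \<alpha> \<in> \<A> \<Longrightarrow> B' \<alpha> = side (v' \<alpha>)"
    using assms(2) unfolding is_open_ball_iff by metis
  have dist: "inv_dist (B \<alpha>) (B \<beta>) = lor (v \<alpha>) (v \<beta>)" "inv_dist (B' \<alpha>) (B' \<beta>) = lor (v' \<alpha>) (v' \<beta>)"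
    if "\<alpha> \<in> \<A>" "\<beta> \<in> \<A>" for \<alpha> \<beta>
    using that v v' by (simp_all add: inv_dist_side)
  have opp: "opposite_ball (B \<alpha>) = side (- v \<alpha>)" if "\<alpha> \<in> \<A>" for \<alpha>
    using that v by (simp add: opposite_ball_side)
  show ?thesis
  proof
    assume "\<exists>f\<in>mobius_group. (\<forall>\<alpha>\<in>\<A>. f ` B \<alpha> = B' \<alpha>) \<or>
                         (\<forall>\<alpha>\<in>\<A>. f ` opposite_ball (B \<alpha>) = B' \<alpha>)"
    then obtain f where f: "f \<in> mobius_group"
      and im: "(\<forall>\<alpha>\<in>\<A>. f ` B \<alpha> = B' \<alpha>) \<or> (\<forall>\<alpha>\<in>\<A>. f ` opposite_ball (B \<alpha>) = B' \<alpha>)"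
      by blast
    obtain T where T: "represents f T" using mobius_represented[OF f] by blast
    then have lorT: "lor (T x) (T y) = lor x y" for x y unfolding represents_def by blast
    \<comment> \<open>The sign \<open>s\<close> unites the two alternatives: \<open>-1\<close>
      stands for opposite balls. It cancels in products of two vectors.\<close>
    have "\<exists>s. s * s = (1::real) \<and> (\<forall>\<alpha>\<in>\<A>. f ` side (s *\<^sub>R v \<alpha>) = side (v' \<alpha>))"
      using im
    proof
      assume "\<forall>\<alpha>\<in>\<A>. f ` B \<alpha> = B' \<alpha>"
      then show ?thesis using v(2) v'(2) by (intro exI[of _ 1]) auto
    next
      assume "\<forall>\<alpha>\<in>\<A>. f ` opposite_ball (B \<alpha>) = B' \<alpha>"
      then show ?thesis using opp v'(2) by (intro exI[of _ "-1"]) auto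
    qed
    then obtain s where s: "s * s = (1::real)" "\<And>\<alpha>. \<alpha> \<in> \<A> \<Longrightarrow> f ` side (s *\<^sub>R v \<alpha>) = side (v' \<alpha>)"
      by blast
    have "T (s *\<^sub>R v \<alpha>) = v' \<alpha>" if "\<alpha> \<in> \<A>" for \<alpha>
      using s that v(1) v'(1)
      by (intro side_eq_imp_eq)
        (simp_all add: lorT lor_simps mult.assoc[symmetric] flip: represents_image_side[OF T])
    then have "lor (v' \<alpha>) (v' \<beta>) = lor (v \<alpha>) (v \<beta>)" if "\<alpha> \<in> \<A>" "\<beta> \<in> \<A>" for \<alpha> \<beta>
      using lorT[of "s *\<^sub>R v \<alpha>" "s *\<^sub>R v \<beta>"] s(1) that by (simp add: lor_simps mult.assoc[symmetric])
    then show "\<forall>\<alpha>\<in>\<A>. \<forall>\<beta>\<in>\<A>. inv_dist (B \<alpha>) (B \<beta>) = inv_dist (B' \<alpha>) (B' \<beta>)"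
      by (simp add: dist)
  next
    assume "\<forall>\<alpha>\<in>\<A>. \<forall>\<beta>\<in>\<A>. inv_dist (B \<alpha>) (B \<beta>) = inv_dist (B' \<alpha>) (B' \<beta>)"
    then have gram: "lor (v' \<alpha>) (v' \<beta>) = lor (v \<alpha>) (v \<beta>)" if "\<alpha> \<in> \<A>" "\<beta> \<in> \<A>" for \<alpha> \<beta>
      using that by (simp add: dist)
    \<comment> \<open>A nonzero null vector orthogonal to all \<open>v \<alpha>\<close> would be a
      multiple of \<open>pt p\<close> with \<open>p\<close> on every bounding sphere.\<close>
    have no_null: "x = 0" if x: "x \<in> lor_perp (v ` \<A>)" "lor x x = 0" for x
    proof (rule ccontr)
      assume "x \<noteq> 0"
      then obtain k p where kp: "k \<noteq> 0" "x = k *\<^sub>R pt p" by (rule null_vector_eq_pt[OF x(2)])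
      have "p \<in> bounding_sphere (B \<alpha>)" if "\<alpha> \<in> \<A>" for \<alpha>
        using that x(1) kp v by (auto simp: bounding_sphere_side zero_set_def lor_perp_def lor_simps)
      then show False using assms(3) by blast
    qed
    obtain T s where T: "T \<in> mobius_isometries" and s: "s = 1 \<or> s = (-1::real)"
      and Tv: "\<And>\<alpha>. \<alpha> \<in> \<A> \<Longrightarrow> T (v \<alpha>) = s *\<^sub>R v' \<alpha>"
      by (rule mobius_isometry_of_family[where v = v and v' = v', OF gram no_null]) auto
    then obtain f where f: "f \<in> mobius_group" "represents f T" by (auto simp: mobius_isometries_def)
    \<comment> \<open>For \<open>s = -1\<close> this turns
      \<open>T (v \<alpha>) = - v' \<alpha>\<close> into a statement about
      \<open>- v \<alpha>\<close>, the vector of the opposite ball.\<close>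
    have "T (- x) = - T x" for x by (simp add: linear_neg linear_mobius_isometry[OF T])
    then have "(\<forall>\<alpha>\<in>\<A>. f ` B \<alpha> = B' \<alpha>) \<or> (\<forall>\<alpha>\<in>\<A>. f ` opposite_ball (B \<alpha>) = B' \<alpha>)"
      using s Tv v(2) v'(2) opp represents_image_side[OF f(2)] by auto
    with f(1) show "\<exists>f\<in>mobius_group. (\<forall>\<alpha>\<in>\<A>. f ` B \<alpha> = B' \<alpha>) \<or>
                         (\<forall>\<alpha>\<in>\<A>. f ` opposite_ball (B \<alpha>) = B' \<alpha>)"
      by blast
  qed
qed

end
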